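(* Let $R$ be a ring. For any pp-pair $\phi/\psi\in\mathcal{L}(R)$, where $\phi$ and $\psi$ are pp-$n$-formulas, with free realisations $(C,\overline{c})$ and $(D,\overline{d})$ respectively, $$w(\phi/\psi)\cong\mathrm{Ann}(D,\overline{d})/\mathrm{Ann}(C,\overline{c}).$$
   Context: $R\text{-}\mathrm{Mod}$, $R\text{-}\mathrm{mod}$ are the categories of left, resp. finitely presented left, $R$-modules. $\mathcal{L}(R)$ is the category of functors $F:R\text{-}\mathrm{Mod}\to\mathrm{Ab}$ for which there is an exact sequence $\mathrm{Hom}_R(B,-)\to\mathrm{Hom}_R(A,-)\to F\to 0$ with $A,B\in R\text{-}\mathrm{mod}$ (an abelian category, kernels and cokernels computed objectwise). $U:R\text{-}\mathrm{Mod}\to\mathrm{Ab}$ is the forgetful functor. A pp-$n$-formula is a subfunctor of $U^n$ lying in $\mathcal{L}(R)$; a pp-pair is a quotient $\phi/\psi$ of pp formulas with $\psi\leqslant\phi$ (inclusion). A free realisation of a pp-$n$-formula $\phi$ is a pair $(C,\overline{c})$ with $C\in R\text{-}\mathrm{mod}$ and $\overline{c}\in C^n$ such that the image of the natural transformation $\mathrm{Hom}_R(C,-)\to U^n$, $f\mapsto f\overline{c}$, is $\phi$. The defect $w$ is the contravariant functor sending a finitely presented functor $F:R\text{-}\mathrm{Mod}\to\mathrm{Ab}$ to a left $R$-module, given as the left adjoint $\mathrm{fp}(R\text{-}\mathrm{Mod},\mathrm{Ab})\to(R\text{-}\mathrm{Mod})^{\mathrm{op}}$ of $M\mapsto\mathrm{Hom}_R(M,-)$;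 explicitly, if $\mathrm{Hom}_R(B,-)\to\mathrm{Hom}_R(A,-)\to F\to 0$ is exact and the first map is induced by $f:A\to B$, then $wF\cong\mathrm{Ker}(f)$. The isomorphism is one of left $R$-modules. For $C\in R\text{-}\mathrm{Mod}$ and $\overline{c}\in C^n$, $\mathrm{Ann}(C,\overline{c})=\{\overline{r}\in R^n:\overline{r}\cdot\overline{c}=0\}$, a left $R$-module, where $\overline{r}\cdot\overline{c}=\sum_{i=1}^n r_ic_i$. *)

theory Defs
  imports "HOL-Algebra.AbelCoset" "HOL-Algebra.Module" "HOL-Algebra.Product_Groups"
begin

section \<open>Left modules over a not necessarily commutative ring\<close>

text \<open>
  The library's locale \<^locale>\<open>module\<close> requires a commutative ring, so left modules get a locale of
  their own. They use the library's record, whose fields \<open>mult\<close> and \<open>one\<close> play no role.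
\<close>

locale left_module = R?: ring R + M?: abelian_group M
  for R :: "('r, 'k) ring_scheme" (structure) and M :: "('r, 'm) module" (structure) +
  assumes smult_closed:
      "\<lbrakk>a \<in> carrier R; x \<in> carrier M\<rbrakk> \<Longrightarrow> a \<odot>\<^bsub>M\<^esub> x \<in> carrier M"
    and smult_l_distr:
      "\<lbrakk>a \<in> carrier R; b \<in> carrier R; x \<in> carrier M\<rbrakk> \<Longrightarrow>
        (a \<oplus> b) \<odot>\<^bsub>M\<^esub> x = a \<odot>\<^bsub>M\<^esub> x \<oplus>\<^bsub>M\<^esub> b \<odot>\<^bsub>M\<^esub> x"
    and smult_r_distr:
      "\<lbrakk>a \<in> carrier R; x \<in> carrier M; y \<in> carrier M\<rbrakk> \<Longrightarrow>
        a \<odot>\<^bsub>M\<^esub> (x \<oplus>\<^bsub>M\<^esub> y) = a \<odot>\<^bsub>M\<^esub> x \<oplus>\<^bsub>M\<^esub> a \<odot>\<^bsub>M\<^esub> y"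
    and smult_assoc1:
      "\<lbrakk>a \<in> carrier R; b \<in> carrier R; x \<in> carrier M\<rbrakk> \<Longrightarrow>
        (a \<otimes> b) \<odot>\<^bsub>M\<^esub> x = a \<odot>\<^bsub>M\<^esub> (b \<odot>\<^bsub>M\<^esub> x)"
    and smult_one:
      "x \<in> carrier M \<Longrightarrow> \<one> \<odot>\<^bsub>M\<^esub> x = x"

text \<open>Homomorphisms are extensional, so that equality in the Hom sets is equality in HOL.\<close>

definition mod_hom ::
  "('r, 'k) ring_scheme \<Rightarrow> ('r, 'a) module \<Rightarrow> ('r, 'b) module \<Rightarrow> ('a \<Rightarrow> 'b) set" where
  "mod_hom R M N = {f \<in> carrier M \<rightarrow>\<^sub>E carrier N.
     (\<forall>x\<in>carrier M. \<forall>y\<in>carrier M. f (x \<oplus>\<^bsub>M\<^esub> y) = f x \<oplus>\<^bsub>N\<^esub> f y) \<and>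
     (\<forall>a\<in>carrier R. \<forall>x\<in>carrier M. f (a \<odot>\<^bsub>M\<^esub> x) = a \<odot>\<^bsub>N\<^esub> f x)}"

definition mod_isomorphic ::
  "('r, 'k) ring_scheme \<Rightarrow> ('r, 'a) module \<Rightarrow> ('r, 'b) module \<Rightarrow> bool" where
  "mod_isomorphic R M N \<longleftrightarrow> (\<exists>f\<in>mod_hom R M N. bij_betw f (carrier M) (carrier N))"

text \<open>The left module \<open>R\<^sup>n\<close>; an \<open>n\<close>-tuple is an extensional function on \<open>{..<n}\<close>.\<close>

definition free_mod :: "('r, 'k) ring_scheme \<Rightarrow> nat \<Rightarrow> ('r, nat \<Rightarrow> 'r) module" where
  "free_mod R n =
     \<lparr>carrier = {..<n} \<rightarrow>\<^sub>E carrier R,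
      mult = undefined, one = undefined,
      zero = (\<lambda>i\<in>{..<n}. \<zero>\<^bsub>R\<^esub>),
      add = (\<lambda>x y. \<lambda>i\<in>{..<n}. x i \<oplus>\<^bsub>R\<^esub> y i),
      smult = (\<lambda>a x. \<lambda>i\<in>{..<n}. a \<otimes>\<^bsub>R\<^esub> x i)\<rparr>"

text \<open>Exactness of some sequence \<open>R\<^sup>k \<rightarrow> R\<^sup>m \<rightarrow> M \<rightarrow> 0\<close>.\<close>

definition fp_module :: "('r, 'k) ring_scheme \<Rightarrow> ('r, 'm) module \<Rightarrow> bool" where
  "fp_module R M \<longleftrightarrow> left_module R M \<and>
     (\<exists>k m. \<exists>q\<in>mod_hom R (free_mod R k) (free_mod R m). \<exists>p\<in>mod_hom R (free_mod R m) M.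
        q ` carrier (free_mod R k) = a_kernel (free_mod R m) M p \<and>
        p ` carrier (free_mod R m) = carrier M)"

text \<open>
  The quotient \<open>M/N\<close> by a submodule \<open>N\<close> of \<open>M\<close>. The scalar action is \<open>a (N + x) = N + a x\<close>, written
  without choosing representatives.
\<close>

definition mod_quotient :: "('r, 'm) module \<Rightarrow> 'm set \<Rightarrow> ('r, 'm set) module" where
  "mod_quotient M N =
     \<lparr>carrier = a_rcosets\<^bsub>M\<^esub> N,
      mult = undefined, one = undefined,
      zero = N,
      add = (\<lambda>X Y. X <+>\<^bsub>M\<^esub> Y),
      smult = (\<lambda>a X. N <+>\<^bsub>M\<^esub> ((\<lambda>x. a \<odot>\<^bsub>M\<^esub> x) ` X))\<rparr>"

definition ann_module ::
  "('r, 'k) ring_scheme \<Rightarrow> nat \<Rightarrow> ('r, 'm) module \<Rightarrow> (nat \<Rightarrow> 'm) \<Rightarrow> ('r, nat \<Rightarrow> 'r) module" where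
  "ann_module R n C c = (free_mod R n)
     \<lparr>carrier := {r \<in> carrier (free_mod R n). (\<Oplus>\<^bsub>C\<^esub>i\<in>{..<n}. r i \<odot>\<^bsub>C\<^esub> c i) = \<zero>\<^bsub>C\<^esub>}\<rparr>"


section \<open>Functors from left modules to abelian groups\<close>

text \<open>
  The objects of \<open>R\<close>-Mod are the \<open>M :: ('r, 'u) module\<close> with \<open>left_module R M\<close>: the type \<open>'u\<close> is the
  universe in which all modules have their elements. As \<open>'u\<close> is a type variable, it can be
  instantiated with arbitrarily large types; every finitely presented module has a copy in \<open>'u\<close> once
  \<open>'u\<close> is infinite and at least as large as \<open>R\<close>, and for infinite \<open>'u\<close> the category has binary
  pushouts. Values of functors are abelian groups, written with the
  library's multiplicative group records. A functor is only constrained on modules and on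
  homomorphisms between them.
\<close>

record ('r, 'u, 'v) mod_functor =
  obj :: "('r, 'u) module \<Rightarrow> 'v monoid"
  arr :: "('r, 'u) module \<Rightarrow> ('r, 'u) module \<Rightarrow> ('u \<Rightarrow> 'u) \<Rightarrow> 'v \<Rightarrow> 'v"

definition is_functor :: "('r, 'k) ring_scheme \<Rightarrow> ('r, 'u, 'v) mod_functor \<Rightarrow> bool" where
  "is_functor R F \<longleftrightarrow>
     (\<forall>M. left_module R M \<longrightarrow> comm_group (obj F M)) \<and>
     (\<forall>M N. left_module R M \<longrightarrow> left_module R N \<longrightarrow>
        (\<forall>f\<in>mod_hom R M N. arr F M N f \<in> hom (obj F M) (obj F N))) \<and>
     (\<forall>M. left_module R M \<longrightarrow>
        (\<forall>x\<in>carrier (obj F M). arr F M M (\<lambda>m\<in>carrier M. m) x = x)) \<and>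
     (\<forall>L M N. left_module R L \<longrightarrow> left_module R M \<longrightarrow> left_module R N \<longrightarrow>
        (\<forall>f\<in>mod_hom R L M. \<forall>g\<in>mod_hom R M N. \<forall>x\<in>carrier (obj F L).
           arr F L N (compose (carrier L) g f) x = arr F M N g (arr F L M f x)))"

definition nat_trans ::
  "('r, 'k) ring_scheme \<Rightarrow> ('r, 'u, 'v) mod_functor \<Rightarrow> ('r, 'u, 'w) mod_functor \<Rightarrow>
   (('r, 'u) module \<Rightarrow> 'v \<Rightarrow> 'w) \<Rightarrow> bool" where
  "nat_trans R F G \<eta> \<longleftrightarrow>
     (\<forall>M. left_module R M \<longrightarrow> \<eta> M \<in> hom (obj F M) (obj G M)) \<and>
     (\<forall>M N. left_module R M \<longrightarrow> left_module R N \<longrightarrow>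
        (\<forall>f\<in>mod_hom R M N. \<forall>x\<in>carrier (obj F M).
           \<eta> N (arr F M N f x) = arr G M N f (\<eta> M x)))"

definition hom_functor :: "('r, 'k) ring_scheme \<Rightarrow> ('r, 'u) module \<Rightarrow> ('r, 'u, 'u \<Rightarrow> 'u) mod_functor" where
  "hom_functor R A =
     \<lparr>obj = (\<lambda>M. \<lparr>carrier = mod_hom R A M,
                  mult = (\<lambda>f g. \<lambda>x\<in>carrier A. f x \<oplus>\<^bsub>M\<^esub> g x),
                  one = (\<lambda>x\<in>carrier A. \<zero>\<^bsub>M\<^esub>)\<rparr>),
      arr = (\<lambda>M N h f. compose (carrier A) h f)\<rparr>"

text \<open>The power \<open>U\<^sup>n\<close> of the forgetful functor \<open>U\<close>.\<close>

definition forgetful_power :: "nat \<Rightarrow> ('r, 'u, nat \<Rightarrow> 'u) mod_functor" where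
  "forgetful_power n =
     \<lparr>obj = (\<lambda>M. product_group {..<n} (\<lambda>_. add_monoid M)),
      arr = (\<lambda>M N f x. \<lambda>i\<in>{..<n}. f (x i))\<rparr>"

text \<open>Subfunctors are given by their values as subsets of the values of the ambient functor.\<close>

definition is_subfunctor ::
  "('r, 'k) ring_scheme \<Rightarrow> ('r, 'u, 'v) mod_functor \<Rightarrow> (('r, 'u) module \<Rightarrow> 'v set) \<Rightarrow> bool" where
  "is_subfunctor R F \<phi> \<longleftrightarrow>
     (\<forall>M. left_module R M \<longrightarrow> subgroup (\<phi> M) (obj F M)) \<and>
     (\<forall>M N. left_module R M \<longrightarrow> left_module R N \<longrightarrow>
        (\<forall>f\<in>mod_hom R M N. arr F M N f ` \<phi> M \<subseteq> \<phi> N))"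

definition subfunctor ::
  "('r, 'u, 'v) mod_functor \<Rightarrow> (('r, 'u) module \<Rightarrow> 'v set) \<Rightarrow> ('r, 'u, 'v) mod_functor" where
  "subfunctor F \<phi> = \<lparr>obj = (\<lambda>M. (obj F M)\<lparr>carrier := \<phi> M\<rparr>), arr = arr F\<rparr>"

definition quotient_functor ::
  "('r, 'u, 'v) mod_functor \<Rightarrow> (('r, 'u) module \<Rightarrow> 'v set) \<Rightarrow> ('r, 'u, 'v set) mod_functor" where
  "quotient_functor F \<psi> =
     \<lparr>obj = (\<lambda>M. obj F M Mod \<psi> M),
      arr = (\<lambda>M N f X. \<psi> N <#>\<^bsub>obj F N\<^esub> (arr F M N f ` X))\<rparr>"

text \<open>
  Existence of an exact sequence \<open>Hom(B,-) \<rightarrow> Hom(A,-) \<rightarrow> F \<rightarrow> 0\<close> with \<open>A\<close> and \<open>B\<close> in the class \<open>S\<close> of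
  modules.
\<close>

definition presented_by ::
  "('r, 'k) ring_scheme \<Rightarrow> (('r, 'u) module \<Rightarrow> bool) \<Rightarrow> ('r, 'u, 'v) mod_functor \<Rightarrow> bool" where
  "presented_by R S F \<longleftrightarrow> is_functor R F \<and>
     (\<exists>A B \<alpha> \<pi>. S A \<and> S B \<and>
        nat_trans R (hom_functor R B) (hom_functor R A) \<alpha> \<and>
        nat_trans R (hom_functor R A) F \<pi> \<and>
        (\<forall>M. left_module R M \<longrightarrow>
           \<alpha> M ` mod_hom R B M = kernel (obj (hom_functor R A) M) (obj F M) (\<pi> M) \<and>
           \<pi> M ` mod_hom R A M = carrier (obj F M)))"

text \<open>The objects of \<open>\<L>(R)\<close>, and those of \<open>fp(R-Mod, Ab)\<close>.\<close>

definition in_L :: "('r, 'k) ring_scheme \<Rightarrow> ('r, 'u, 'v) mod_functor \<Rightarrow> bool" where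
  "in_L R F \<longleftrightarrow> presented_by R (fp_module R) F"

definition fp_functor :: "('r, 'k) ring_scheme \<Rightarrow> ('r, 'u, 'v) mod_functor \<Rightarrow> bool" where
  "fp_functor R F \<longleftrightarrow> presented_by R (left_module R) F"


section \<open>pp formulas, free realisations and the defect\<close>

definition pp_formula ::
  "('r, 'k) ring_scheme \<Rightarrow> nat \<Rightarrow> (('r, 'u) module \<Rightarrow> (nat \<Rightarrow> 'u) set) \<Rightarrow> bool" where
  "pp_formula R n \<phi> \<longleftrightarrow>
     is_subfunctor R (forgetful_power n) \<phi> \<and> in_L R (subfunctor (forgetful_power n) \<phi>)"

definition pp_le ::
  "('r, 'k) ring_scheme \<Rightarrow> (('r, 'u) module \<Rightarrow> (nat \<Rightarrow> 'u) set) \<Rightarrow>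
   (('r, 'u) module \<Rightarrow> (nat \<Rightarrow> 'u) set) \<Rightarrow> bool" where
  "pp_le R \<psi> \<phi> \<longleftrightarrow> (\<forall>M. left_module R M \<longrightarrow> \<psi> M \<subseteq> \<phi> M)"

definition pp_pair ::
  "nat \<Rightarrow> (('r, 'u) module \<Rightarrow> (nat \<Rightarrow> 'u) set) \<Rightarrow> (('r, 'u) module \<Rightarrow> (nat \<Rightarrow> 'u) set) \<Rightarrow>
   ('r, 'u, (nat \<Rightarrow> 'u) set) mod_functor" where
  "pp_pair n \<phi> \<psi> = quotient_functor (subfunctor (forgetful_power n) \<phi>) \<psi>"

definition free_realisation ::
  "('r, 'k) ring_scheme \<Rightarrow> nat \<Rightarrow> (('r, 'u) module \<Rightarrow> (nat \<Rightarrow> 'u) set) \<Rightarrow>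
   ('r, 'u) module \<Rightarrow> (nat \<Rightarrow> 'u) \<Rightarrow> bool" where
  "free_realisation R n \<phi> C c \<longleftrightarrow>
     fp_module R C \<and> c \<in> {..<n} \<rightarrow>\<^sub>E carrier C \<and>
     (\<forall>M. left_module R M \<longrightarrow> (\<lambda>f. \<lambda>i\<in>{..<n}. f (c i)) ` mod_hom R C M = \<phi> M)"

text \<open>
  \<open>W\<close> is a value at \<open>F\<close> of the left adjoint \<open>w : fp(R-Mod, Ab) \<rightarrow> (R-Mod)\<^sup>o\<^sup>p\<close> of \<open>M \<mapsto> Hom(M,-)\<close>, and
  \<open>\<eta> : F \<rightarrow> Hom(W,-)\<close> is the unit of the adjunction at \<open>F\<close>: every \<open>\<theta> : F \<rightarrow> Hom(M,-)\<close> is \<open>\<eta>\<close> followed by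
  \<open>Hom(g,-) : Hom(W,-) \<rightarrow> Hom(M,-)\<close> for a unique \<open>g : M \<rightarrow> W\<close>. This determines \<open>W\<close> up to isomorphism.
\<close>

definition is_defect ::
  "('r, 'k) ring_scheme \<Rightarrow> ('r, 'u, 'v) mod_functor \<Rightarrow> ('r, 'u) module \<Rightarrow>
   (('r, 'u) module \<Rightarrow> 'v \<Rightarrow> 'u \<Rightarrow> 'u) \<Rightarrow> bool" where
  "is_defect R F W \<eta> \<longleftrightarrow>
     fp_functor R F \<and> left_module R W \<and> nat_trans R F (hom_functor R W) \<eta> \<and>
     (\<forall>M \<theta>. left_module R M \<longrightarrow> nat_trans R F (hom_functor R M) \<theta> \<longrightarrow>
        (\<exists>!g. g \<in> mod_hom R M W \<and>
           (\<forall>N. left_module R N \<longrightarrow>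
              (\<forall>x\<in>carrier (obj F N). \<theta> N x = compose (carrier M) (\<eta> N x) g))))"

end

theory Submission
  imports Defs
begin

text \<open>
  Let \<open>P\<close> be the pushout of the maps \<open>R\<^sup>n \<rightarrow> C\<close> and \<open>R\<^sup>n \<rightarrow> D\<close> given by the tuples \<open>c\<close> and \<open>d\<close>, and let
  \<open>p : C \<rightarrow> P\<close> be the canonical map. Evaluation at \<open>c\<close> is a surjection \<open>Hom(C,-) \<rightarrow> \<phi>\<close>. Followed by
  \<open>\<phi> \<rightarrow> \<phi>/\<psi>\<close> it kills exactly those \<open>f\<close> with \<open>f c \<in> \<psi> M\<close>, that is, with \<open>f c = h d\<close> for some \<open>h : D \<rightarrow> M\<close>;
  these are the \<open>f\<close> that factor through \<open>p\<close>. Thus \<open>Hom(P,-) \<rightarrow> Hom(C,-) \<rightarrow> \<phi>/\<psi> \<rightarrow> 0\<close> is exact and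
  \<open>w(\<phi>/\<psi>) = Ker p\<close>. By the construction of the pushout, \<open>Ker p\<close> consists of the linear combinations of \<open>c\<close>
  whose coefficients annihilate \<open>d\<close>: it is the image of \<open>Ann(D, d)\<close> in \<open>C\<close>. The kernel of the map from
  \<open>Ann(D, d)\<close> onto it is \<open>Ann(C, c)\<close>, which is contained in \<open>Ann(D, d)\<close> because \<open>\<psi> \<le> \<phi>\<close> provides a
  map \<open>C \<rightarrow> D\<close> that takes \<open>c\<close> to \<open>d\<close>. The first isomorphism theorem finishes the proof.

  The general ingredients are \<open>pushout_in_universe\<close>, which constructs \<open>P\<close> without leaving the type in
  which all modules have their elements, \<open>defect_of_presentation\<close>, the formula for the defect as a
  kernel, \<open>defect_unique\<close>, which transfers the result to every other value of the adjoint, and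
  \<open>first_isomorphism\<close>.
\<close>

section \<open>Left modules and their homomorphisms\<close>

lemma mod_homD:
  assumes "f \<in> mod_hom R M N"
  shows "f \<in> carrier M \<rightarrow>\<^sub>E carrier N"
    and "x \<in> carrier M \<Longrightarrow> f x \<in> carrier N"
    and "x \<in> carrier M \<Longrightarrow> y \<in> carrier M \<Longrightarrow> f (x \<oplus>\<^bsub>M\<^esub> y) = f x \<oplus>\<^bsub>N\<^esub> f y"
    and "a \<in> carrier R \<Longrightarrow> x \<in> carrier M \<Longrightarrow> f (a \<odot>\<^bsub>M\<^esub> x) = a \<odot>\<^bsub>N\<^esub> f x"
  using assms by (auto simp: mod_hom_def)

lemma mod_homI:
  assumes "f \<in> carrier M \<rightarrow>\<^sub>E carrier N"
    and "\<And>x y. x \<in> carrier M \<Longrightarrow> y \<in> carrier M \<Longrightarrow> f (x \<oplus>\<^bsub>M\<^esub> y) = f x \<oplus>\<^bsub>N\<^esub> f y"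
    and "\<And>a x. a \<in> carrier R \<Longrightarrow> x \<in> carrier M \<Longrightarrow> f (a \<odot>\<^bsub>M\<^esub> x) = a \<odot>\<^bsub>N\<^esub> f x"
  shows "f \<in> mod_hom R M N"
  using assms by (auto simp: mod_hom_def)

lemma mod_hom_eqI:
  assumes "f \<in> mod_hom R M N" "g \<in> mod_hom R M N" "\<And>x. x \<in> carrier M \<Longrightarrow> f x = g x"
  shows "f = g"
  using assms(3) by (intro PiE_ext[OF mod_homD(1)[OF assms(1)]])
    (use mod_homD(1)[OF assms(2)] mod_homD(2)[OF assms(1)] in \<open>auto simp: PiE_def extensional_def\<close>)

lemma left_moduleI:
  assumes "ring R" "abelian_group M"
    and "\<And>a x. a \<in> carrier R \<Longrightarrow> x \<in> carrier M \<Longrightarrow> a \<odot>\<^bsub>M\<^esub> x \<in> carrier M"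
    and "\<And>a b x. a \<in> carrier R \<Longrightarrow> b \<in> carrier R \<Longrightarrow> x \<in> carrier M \<Longrightarrow>
      (a \<oplus>\<^bsub>R\<^esub> b) \<odot>\<^bsub>M\<^esub> x = a \<odot>\<^bsub>M\<^esub> x \<oplus>\<^bsub>M\<^esub> b \<odot>\<^bsub>M\<^esub> x"
    and "\<And>a x y. a \<in> carrier R \<Longrightarrow> x \<in> carrier M \<Longrightarrow> y \<in> carrier M \<Longrightarrow>
      a \<odot>\<^bsub>M\<^esub> (x \<oplus>\<^bsub>M\<^esub> y) = a \<odot>\<^bsub>M\<^esub> x \<oplus>\<^bsub>M\<^esub> a \<odot>\<^bsub>M\<^esub> y"
    and "\<And>a b x. a \<in> carrier R \<Longrightarrow> b \<in> carrier R \<Longrightarrow> x \<in> carrier M \<Longrightarrow>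
      (a \<otimes>\<^bsub>R\<^esub> b) \<odot>\<^bsub>M\<^esub> x = a \<odot>\<^bsub>M\<^esub> (b \<odot>\<^bsub>M\<^esub> x)"
    and "\<And>x. x \<in> carrier M \<Longrightarrow> \<one>\<^bsub>R\<^esub> \<odot>\<^bsub>M\<^esub> x = x"
  shows "left_module R M"
  using assms by (intro left_module.intro left_module_axioms.intro)

lemma left_moduleD:
  assumes "left_module R M" shows "ring R" "abelian_group M"
  using assms by (auto simp: left_module_def)

lemma mod_hom_abelian_group_hom:
  assumes "left_module R M" "left_module R N" "f \<in> mod_hom R M N"
  shows "abelian_group_hom M N f"
  using left_moduleD(2)[OF assms(1)] left_moduleD(2)[OF assms(2)] mod_homD[OF assms(3)]
  by (intro abelian_group_homI group_hom.intro group_hom_axioms.intro)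
     (auto simp: hom_def abelian_group.a_group)

lemma mod_hom_zero:
  assumes "left_module R M" "left_module R N" "f \<in> mod_hom R M N"
  shows "f \<zero>\<^bsub>M\<^esub> = \<zero>\<^bsub>N\<^esub>"
  using abelian_group_hom.hom_zero[OF mod_hom_abelian_group_hom[OF assms]] .

lemma mod_hom_minus:
  assumes "left_module R M" "left_module R N" "f \<in> mod_hom R M N" "x \<in> carrier M"
  shows "f (\<ominus>\<^bsub>M\<^esub> x) = \<ominus>\<^bsub>N\<^esub> f x"
  using abelian_group_hom.hom_a_inv[OF mod_hom_abelian_group_hom[OF assms(1-3)] assms(4)] .

lemma mod_hom_compose:
  assumes "left_module R L" "f \<in> mod_hom R L M" "g \<in> mod_hom R M N"
  shows "compose (carrier L) g f \<in> mod_hom R L N"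
proof -
  interpret L: left_module R L by fact
  show ?thesis
    using mod_homD[OF assms(2)] mod_homD[OF assms(3)]
    by (intro mod_homI) (auto simp: compose_def L.smult_closed)
qed

lemma mod_hom_id:
  assumes "left_module R M"
  shows "(\<lambda>x\<in>carrier M. x) \<in> mod_hom R M M"
proof -
  interpret left_module R M by fact
  show ?thesis by (intro mod_homI) (auto simp: smult_closed)
qed

context left_module
begin

lemma smult_left_hom:
  assumes "x \<in> carrier M"
  shows "abelian_group_hom R M (\<lambda>a. a \<odot>\<^bsub>M\<^esub> x)"
  by (intro abelian_group_homI group_hom.intro group_hom_axioms.intro)
     (use assms in \<open>auto simp: hom_def R.abelian_group_axioms M.abelian_group_axioms R.a_group M.a_group
        smult_closed smult_l_distr\<close>)

lemma smult_right_hom: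
  assumes "a \<in> carrier R"
  shows "abelian_group_hom M M (\<lambda>x. a \<odot>\<^bsub>M\<^esub> x)"
  by (intro abelian_group_homI group_hom.intro group_hom_axioms.intro)
     (use assms in \<open>auto simp: hom_def M.abelian_group_axioms M.a_group smult_closed smult_r_distr\<close>)

lemma smult_zero: "a \<in> carrier R \<Longrightarrow> a \<odot>\<^bsub>M\<^esub> \<zero>\<^bsub>M\<^esub> = \<zero>\<^bsub>M\<^esub>"
  using abelian_group_hom.hom_zero[OF smult_right_hom] .

lemma zero_smult: "x \<in> carrier M \<Longrightarrow> \<zero> \<odot>\<^bsub>M\<^esub> x = \<zero>\<^bsub>M\<^esub>"
  using abelian_group_hom.hom_zero[OF smult_left_hom] .

lemma smult_minus: "a \<in> carrier R \<Longrightarrow> x \<in> carrier M \<Longrightarrow> a \<odot>\<^bsub>M\<^esub> (\<ominus>\<^bsub>M\<^esub> x) = \<ominus>\<^bsub>M\<^esub> (a \<odot>\<^bsub>M\<^esub> x)"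
  using abelian_group_hom.hom_a_inv[OF smult_right_hom] .

lemma minus_one_smult: "x \<in> carrier M \<Longrightarrow> (\<ominus> \<one>) \<odot>\<^bsub>M\<^esub> x = \<ominus>\<^bsub>M\<^esub> x"
  using abelian_group_hom.hom_a_inv[OF smult_left_hom, of x "\<one>"] by (simp add: smult_one)

end

lemma (in abelian_group) minus_eq_zero_iff:
  assumes "x \<in> carrier G" "y \<in> carrier G"
  shows "x \<ominus> y = \<zero> \<longleftrightarrow> x = y"
  using assms by (metis a_minus_def a_inv_closed minus_equality minus_minus r_neg)

lemma mod_hom_minus_distrib:
  assumes "left_module R M" "left_module R N" "f \<in> mod_hom R M N" "x \<in> carrier M" "y \<in> carrier M"
  shows "f (x \<ominus>\<^bsub>M\<^esub> y) = f x \<ominus>\<^bsub>N\<^esub> f y"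
proof -
  interpret M: left_module R M by fact
  show ?thesis
    using assms(4,5) mod_hom_minus[OF assms(1-3)] mod_homD(3)[OF assms(3)] by (simp add: a_minus_def)
qed

lemma mod_hom_cong_kernel:
  assumes "left_module R M" "left_module R X" "k \<in> mod_hom R M X"
    and "\<And>x. x \<in> N \<Longrightarrow> k x = \<zero>\<^bsub>X\<^esub>"
    and "x \<in> carrier M" "y \<in> carrier M" "x \<ominus>\<^bsub>M\<^esub> y \<in> N"
  shows "k x = k y"
proof -
  interpret M: left_module R M by fact
  interpret X: left_module R X by fact
  have "k x \<ominus>\<^bsub>X\<^esub> k y = k (x \<ominus>\<^bsub>M\<^esub> y)"
    using mod_hom_minus_distrib[OF assms(1-3,5,6)] by simp
  also have "\<dots> = \<zero>\<^bsub>X\<^esub>" using assms(4,7) by blast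
  finally show ?thesis
    using mod_homD(2)[OF assms(3)] assms(5,6) by (simp add: X.minus_eq_zero_iff)
qed

text \<open>
  Quotients, and copies of a module along an injection, satisfy the module axioms for the same
  reason: every axiom is an equation between values of a surjection that respects the operations.
\<close>

lemma left_module_image:
  assumes M: "left_module R M"
    and onto: "f ` carrier M = carrier Q"
    and add: "\<And>x y. x \<in> carrier M \<Longrightarrow> y \<in> carrier M \<Longrightarrow> f x \<oplus>\<^bsub>Q\<^esub> f y = f (x \<oplus>\<^bsub>M\<^esub> y)"
    and zero: "\<zero>\<^bsub>Q\<^esub> = f \<zero>\<^bsub>M\<^esub>"
    and smult: "\<And>a x. a \<in> carrier R \<Longrightarrow> x \<in> carrier M \<Longrightarrow> a \<odot>\<^bsub>Q\<^esub> f x = f (a \<odot>\<^bsub>M\<^esub> x)"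
  shows "left_module R Q" and "restrict f (carrier M) \<in> mod_hom R M Q"
proof -
  interpret M: left_module R M by fact
  have abelian: "abelian_group Q"
  proof (rule abelian_groupI; (unfold onto[symmetric])?)
    show "\<exists>y\<in>f ` carrier M. y \<oplus>\<^bsub>Q\<^esub> x = \<zero>\<^bsub>Q\<^esub>" if x: "x \<in> f ` carrier M" for x
    proof -
      from x obtain z where z: "z \<in> carrier M" "x = f z" by auto
      have "f (\<ominus>\<^bsub>M\<^esub> z) \<oplus>\<^bsub>Q\<^esub> x = \<zero>\<^bsub>Q\<^esub>"
        using z by (simp add: add zero M.l_neg)
      with z show ?thesis by blast
    qed
  qed (auto simp: add zero M.a_ac M.l_zero)
  show "left_module R Q"
    by (rule left_moduleI; (unfold onto[symmetric])?)
       (auto simp: add smult abelian M.R.ring_axioms M.smult_closed M.smult_l_distr M.smult_r_distr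
         M.smult_assoc1 M.smult_one)
  show "restrict f (carrier M) \<in> mod_hom R M Q"
    by (rule mod_homI) (auto simp: add smult onto[symmetric] M.smult_closed)
qed

lemma mod_hom_descends:
  assumes M: "left_module R M"
    and q: "q \<in> mod_hom R M Q" and onto: "q ` carrier M = carrier Q"
    and k: "k \<in> mod_hom R M X"
    and resp: "\<And>x y. x \<in> carrier M \<Longrightarrow> y \<in> carrier M \<Longrightarrow> q x = q y \<Longrightarrow> k x = k y"
  shows "\<exists>k'\<in>mod_hom R Q X. \<forall>x\<in>carrier M. k' (q x) = k x"
proof -
  interpret M: left_module R M by fact
  define k' where "k' = (\<lambda>z\<in>carrier Q. k (inv_into (carrier M) q z))"
  have k': "k' (q x) = k x" if "x \<in> carrier M" for x
  proof -
    have "q x \<in> q ` carrier M" using that by simp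
    then have "k (inv_into (carrier M) q (q x)) = k x"
      by (intro resp inv_into_into f_inv_into_f that)
    then show ?thesis
      using mod_homD(2)[OF q that] by (simp add: k'_def)
  qed
  have "k' \<in> mod_hom R Q X"
  proof (rule mod_homI)
    show "k' \<in> carrier Q \<rightarrow>\<^sub>E carrier X"
      unfolding k'_def
      by (intro restrict_PiE_iff[THEN iffD2] ballI mod_homD(2)[OF k] inv_into_into) (simp add: onto)
  next
    fix u v assume "u \<in> carrier Q" "v \<in> carrier Q"
    then obtain x y where xy: "x \<in> carrier M" "y \<in> carrier M" "u = q x" "v = q y"
      using onto by blast
    then have "k' (u \<oplus>\<^bsub>Q\<^esub> v) = k' (q (x \<oplus>\<^bsub>M\<^esub> y))"
      using mod_homD(3)[OF q] by simp
    then show "k' (u \<oplus>\<^bsub>Q\<^esub> v) = k' u \<oplus>\<^bsub>X\<^esub> k' v"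
      using xy by (simp add: k' mod_homD(3)[OF k])
  next
    fix a u assume a: "a \<in> carrier R" and "u \<in> carrier Q"
    then obtain x where x: "x \<in> carrier M" "u = q x" using onto by blast
    then have "k' (a \<odot>\<^bsub>Q\<^esub> u) = k' (q (a \<odot>\<^bsub>M\<^esub> x))"
      using a mod_homD(4)[OF q] by simp
    then show "k' (a \<odot>\<^bsub>Q\<^esub> u) = a \<odot>\<^bsub>X\<^esub> k' u"
      using x a by (simp add: k' mod_homD(4)[OF k] M.smult_closed)
  qed
  then show ?thesis using k' by blast
qed

section \<open>Submodules and quotients\<close>

definition submodule_of :: "('r, 'k) ring_scheme \<Rightarrow> 'm set \<Rightarrow> ('r, 'm) module \<Rightarrow> bool" where
  "submodule_of R N M \<longleftrightarrow> N \<subseteq> carrier M \<and> \<zero>\<^bsub>M\<^esub> \<in> N \<and>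
     (\<forall>x\<in>N. \<forall>y\<in>N. x \<oplus>\<^bsub>M\<^esub> y \<in> N) \<and> (\<forall>a\<in>carrier R. \<forall>x\<in>N. a \<odot>\<^bsub>M\<^esub> x \<in> N)"

lemma submodule_of_abelian_subgroup:
  assumes "left_module R M" "submodule_of R N M"
  shows "abelian_subgroup N M"
proof -
  interpret left_module R M by fact
  have minus: "\<ominus>\<^bsub>M\<^esub> x \<in> N" if "x \<in> N" for x
  proof -
    have "(\<ominus>\<^bsub>R\<^esub> \<one>\<^bsub>R\<^esub>) \<odot>\<^bsub>M\<^esub> x \<in> N" using that assms(2) by (auto simp: submodule_of_def)
    moreover have "x \<in> carrier M" using that assms(2) by (auto simp: submodule_of_def)
    ultimately show ?thesis by (simp add: minus_one_smult)
  qed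
  have "subgroup N (add_monoid M)"
    using assms(2) minus[unfolded a_inv_def]
    by (intro subgroup.intro) (auto simp: submodule_of_def)
  then show ?thesis
    by (intro abelian_subgroupI3 additive_subgroupI M.abelian_group_axioms)
qed

lemma left_module_submodule:
  assumes "left_module R M" "submodule_of R N M"
  shows "left_module R (M\<lparr>carrier := N\<rparr>)"
proof -
  interpret left_module R M by fact
  interpret N: abelian_subgroup N M using submodule_of_abelian_subgroup[OF assms] .
  have N: "x \<in> carrier M" if "x \<in> N" for x
    using assms(2) that by (auto simp: submodule_of_def)
  have closed: "x \<oplus>\<^bsub>M\<^esub> y \<in> N" "a \<odot>\<^bsub>M\<^esub> x \<in> N" "\<zero>\<^bsub>M\<^esub> \<in> N" if "x \<in> N" "y \<in> N" "a \<in> carrier R" for x y a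
    using assms(2) that by (auto simp: submodule_of_def)
  have "abelian_group (M\<lparr>carrier := N\<rparr>)"
  proof (rule abelian_groupI)
    show "\<exists>y\<in>carrier (M\<lparr>carrier := N\<rparr>). y \<oplus>\<^bsub>M\<lparr>carrier := N\<rparr>\<^esub> x = \<zero>\<^bsub>M\<lparr>carrier := N\<rparr>\<^esub>"
      if "x \<in> carrier (M\<lparr>carrier := N\<rparr>)" for x
      using that N M.l_neg[of x] by (auto intro!: bexI[of _ "\<ominus>\<^bsub>M\<^esub> x"])
  qed (simp_all add: N closed M.a_ac)
  then show ?thesis
    by (intro left_moduleI)
       (simp_all add: R.ring_axioms N closed smult_l_distr smult_r_distr smult_assoc1 smult_one)
qed

lemma submodule_kernel:
  assumes "left_module R M" "left_module R N" "f \<in> mod_hom R M N"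
  shows "submodule_of R {x \<in> carrier M. f x = \<zero>\<^bsub>N\<^esub>} M"
proof -
  interpret M: left_module R M by fact
  interpret N: left_module R N by fact
  show ?thesis
    using mod_homD[OF assms(3)] mod_hom_zero[OF assms]
    by (simp add: submodule_of_def M.smult_closed N.smult_zero)
qed

lemma submodule_image:
  assumes "left_module R M" "left_module R N" "f \<in> mod_hom R M N" "submodule_of R K M"
  shows "submodule_of R (f ` K) N"
  unfolding submodule_of_def
proof (intro conjI ballI)
  have K: "x \<in> K \<Longrightarrow> x \<in> carrier M" for x using assms(4) by (auto simp: submodule_of_def)
  show "f ` K \<subseteq> carrier N" using K mod_homD(2)[OF assms(3)] by auto
  show "\<zero>\<^bsub>N\<^esub> \<in> f ` K"
    using mod_hom_zero[OF assms(1-3)] assms(4) by (metis image_eqI submodule_of_def)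
  show "u \<oplus>\<^bsub>N\<^esub> v \<in> f ` K" if "u \<in> f ` K" "v \<in> f ` K" for u v
  proof -
    from that obtain x y where "x \<in> K" "y \<in> K" "u = f x" "v = f y" by blast
    then show ?thesis
      using K mod_homD(3)[OF assms(3), of x y] assms(4)
      by (auto simp: submodule_of_def intro!: image_eqI[of _ f "x \<oplus>\<^bsub>M\<^esub> y"])
  qed
  show "a \<odot>\<^bsub>N\<^esub> u \<in> f ` K" if "a \<in> carrier R" "u \<in> f ` K" for a u
  proof -
    from that obtain x where "x \<in> K" "u = f x" by blast
    then show ?thesis
      using K that(1) mod_homD(4)[OF assms(3), of a x] assms(4)
      by (auto simp: submodule_of_def intro!: image_eqI[of _ f "a \<odot>\<^bsub>M\<^esub> x"])
  qed
qed

lemma submodule_carrier: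
  assumes "left_module R M" shows "submodule_of R (carrier M) M"
proof -
  interpret left_module R M by fact
  show ?thesis by (simp add: submodule_of_def smult_closed)
qed

lemma mod_hom_restrict:
  assumes "f \<in> mod_hom R M N" "K \<subseteq> carrier M" "f ` K \<subseteq> L" "submodule_of R K M"
  shows "restrict f K \<in> mod_hom R (M\<lparr>carrier := K\<rparr>) (N\<lparr>carrier := L\<rparr>)"
  using assms mod_homD[OF assms(1)]
  by (intro mod_homI) (auto simp: submodule_of_def subset_iff image_subset_iff)

text \<open>
  The scalar action on cosets is \<open>a (N + x) = N + a (N + x)\<close>. The outer \<open>N\<close> is needed because
  \<open>a (N + x)\<close> need not be a whole coset; it is contained in \<open>N + a x\<close> since \<open>a N \<subseteq> N\<close>.
\<close>

lemma mod_quotient: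
  assumes "left_module R M" "submodule_of R N M"
  shows "left_module R (mod_quotient M N)"
    and "(\<lambda>x\<in>carrier M. N +>\<^bsub>M\<^esub> x) \<in> mod_hom R M (mod_quotient M N)"
    and "(\<lambda>x. N +>\<^bsub>M\<^esub> x) ` carrier M = carrier (mod_quotient M N)"
    and "\<And>x y. x \<in> carrier M \<Longrightarrow> y \<in> carrier M \<Longrightarrow>
      N +>\<^bsub>M\<^esub> x = N +>\<^bsub>M\<^esub> y \<longleftrightarrow> x \<ominus>\<^bsub>M\<^esub> y \<in> N"
proof -
  interpret left_module R M by fact
  interpret N: abelian_subgroup N M using submodule_of_abelian_subgroup[OF assms] .
  show onto: "(\<lambda>x. N +>\<^bsub>M\<^esub> x) ` carrier M = carrier (mod_quotient M N)"
    by (auto simp: mod_quotient_def A_RCOSETS_def')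
  have smult: "N <+>\<^bsub>M\<^esub> ((\<lambda>z. a \<odot>\<^bsub>M\<^esub> z) ` (N +>\<^bsub>M\<^esub> x)) = N +>\<^bsub>M\<^esub> (a \<odot>\<^bsub>M\<^esub> x)"
    if a: "a \<in> carrier R" and x: "x \<in> carrier M" for a x
  proof (rule Set.set_eqI)
    fix z
    have aN: "a \<odot>\<^bsub>M\<^esub> k \<in> N" if "k \<in> N" for k using assms(2) a that by (auto simp: submodule_of_def)
    show "z \<in> N <+>\<^bsub>M\<^esub> ((\<lambda>z. a \<odot>\<^bsub>M\<^esub> z) ` (N +>\<^bsub>M\<^esub> x)) \<longleftrightarrow> z \<in> N +>\<^bsub>M\<^esub> (a \<odot>\<^bsub>M\<^esub> x)"
    proof
      assume "z \<in> N <+>\<^bsub>M\<^esub> ((\<lambda>z. a \<odot>\<^bsub>M\<^esub> z) ` (N +>\<^bsub>M\<^esub> x))"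
      then obtain h k where hk: "h \<in> N" "k \<in> N" "z = h \<oplus>\<^bsub>M\<^esub> a \<odot>\<^bsub>M\<^esub> (k \<oplus>\<^bsub>M\<^esub> x)"
        by (auto simp: set_add_def' a_r_coset_def')
      then have "z = (h \<oplus>\<^bsub>M\<^esub> a \<odot>\<^bsub>M\<^esub> k) \<oplus>\<^bsub>M\<^esub> a \<odot>\<^bsub>M\<^esub> x"
        using a x by (simp add: smult_r_distr smult_closed M.a_assoc)
      moreover have "h \<oplus>\<^bsub>M\<^esub> a \<odot>\<^bsub>M\<^esub> k \<in> N" using hk aN by auto
      ultimately show "z \<in> N +>\<^bsub>M\<^esub> (a \<odot>\<^bsub>M\<^esub> x)"
        by (auto simp: a_r_coset_def')
    next
      assume "z \<in> N +>\<^bsub>M\<^esub> (a \<odot>\<^bsub>M\<^esub> x)"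
      then obtain h where h: "h \<in> N" "z = h \<oplus>\<^bsub>M\<^esub> a \<odot>\<^bsub>M\<^esub> x"
        by (auto simp: a_r_coset_def')
      moreover have "x \<in> N +>\<^bsub>M\<^esub> x" using x by (rule N.a_rcos_self)
      ultimately show "z \<in> N <+>\<^bsub>M\<^esub> ((\<lambda>z. a \<odot>\<^bsub>M\<^esub> z) ` (N +>\<^bsub>M\<^esub> x))"
        by (auto simp: set_add_def')
    qed
  qed
  have zero: "N +>\<^bsub>M\<^esub> \<zero>\<^bsub>M\<^esub> = N"
    by (rule M.a_coset_add_zero) (rule N.a_subset)
  show "left_module R (mod_quotient M N)"
    "(\<lambda>x\<in>carrier M. N +>\<^bsub>M\<^esub> x) \<in> mod_hom R M (mod_quotient M N)"
    by (rule left_module_image[OF assms(1) onto];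
        simp add: mod_quotient_def N.a_rcos_sum smult zero)+
  show "N +>\<^bsub>M\<^esub> x = N +>\<^bsub>M\<^esub> y \<longleftrightarrow> x \<ominus>\<^bsub>M\<^esub> y \<in> N"
    if xy: "x \<in> carrier M" "y \<in> carrier M" for x y
  proof -
    have "x \<ominus>\<^bsub>M\<^esub> y \<in> N \<longleftrightarrow> x \<in> N +>\<^bsub>M\<^esub> y"
      using N.a_rcos_module[OF xy(2,1)] by (simp add: a_minus_def)
    then show ?thesis
      using N.a_rcos_self[OF xy(1)] N.a_repr_independence'[OF _ xy(2)] by metis
  qed
qed

text \<open>
  The map \<open>f\<close> and the projection \<open>M \<rightarrow> M/Ker f\<close> identify the same pairs of elements, so the projection
  descends along \<open>f\<close> to a bijection.
\<close>

lemma first_isomorphism: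
  assumes M: "left_module R M" and W: "left_module R W"
    and f: "f \<in> mod_hom R M W" and onto: "f ` carrier M = carrier W"
  shows "mod_isomorphic R W (mod_quotient M {x \<in> carrier M. f x = \<zero>\<^bsub>W\<^esub>})"
proof -
  let ?K = "{x \<in> carrier M. f x = \<zero>\<^bsub>W\<^esub>}"
  have K: "submodule_of R ?K M" by (rule submodule_kernel[OF M W f])
  interpret M: left_module R M by fact
  interpret W: left_module R W by fact
  have eq: "x \<ominus>\<^bsub>M\<^esub> y \<in> ?K \<longleftrightarrow> f x = f y" if "x \<in> carrier M" "y \<in> carrier M" for x y
  proof -
    have "f (x \<ominus>\<^bsub>M\<^esub> y) = f x \<ominus>\<^bsub>W\<^esub> f y" by (rule mod_hom_minus_distrib[OF M W f that])
    moreover have "x \<ominus>\<^bsub>M\<^esub> y \<in> carrier M" using that by simp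
    ultimately show ?thesis
      using W.minus_eq_zero_iff[of "f x" "f y"] mod_homD(2)[OF f that(1)] mod_homD(2)[OF f that(2)] by simp
  qed
  have "\<exists>g\<in>mod_hom R W (mod_quotient M ?K).
      \<forall>x\<in>carrier M. g (f x) = (\<lambda>x\<in>carrier M. ?K +>\<^bsub>M\<^esub> x) x"
  proof (rule mod_hom_descends[OF M f onto mod_quotient(2)[OF M K]])
    show "(\<lambda>x\<in>carrier M. ?K +>\<^bsub>M\<^esub> x) x = (\<lambda>x\<in>carrier M. ?K +>\<^bsub>M\<^esub> x) y"
      if xy: "x \<in> carrier M" "y \<in> carrier M" and "f x = f y" for x y
    proof -
      have "?K +>\<^bsub>M\<^esub> x = ?K +>\<^bsub>M\<^esub> y"
        using mod_quotient(4)[OF M K xy] eq[OF xy] \<open>f x = f y\<close> by blast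
      then show ?thesis using xy by (simp only: restrict_apply')
    qed
  qed
  then obtain g where g: "g \<in> mod_hom R W (mod_quotient M ?K)"
    and gf: "\<And>x. x \<in> carrier M \<Longrightarrow> g (f x) = ?K +>\<^bsub>M\<^esub> x"
    by (metis (no_types, lifting) restrict_apply')
  have "inj_on g (carrier W)"
  proof (rule inj_onI)
    fix u v assume W: "u \<in> carrier W" "v \<in> carrier W" and guv: "g u = g v"
    obtain x y where xy: "x \<in> carrier M" "y \<in> carrier M" and uv: "u = f x" "v = f y"
      using W unfolding onto[symmetric] by blast
    have "?K +>\<^bsub>M\<^esub> x = ?K +>\<^bsub>M\<^esub> y"
      using guv gf[OF xy(1)] gf[OF xy(2)] xy by (simp only: uv)
    then show "u = v" using mod_quotient(4)[OF M K xy] eq[OF xy] uv by blast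
  qed
  moreover have "g ` carrier W = carrier (mod_quotient M ?K)"
  proof -
    have "g ` carrier W = (\<lambda>x. g (f x)) ` carrier M" by (simp only: onto[symmetric] image_image)
    also have "\<dots> = (\<lambda>x. ?K +>\<^bsub>M\<^esub> x) ` carrier M"
      by (rule image_cong[OF refl gf])
    also have "\<dots> = carrier (mod_quotient M ?K)" by (rule mod_quotient(3)[OF M K])
    finally show ?thesis .
  qed
  ultimately show ?thesis
    unfolding mod_isomorphic_def by (intro bexI[OF _ g] bij_betw_imageI)
qed

lemma mod_isomorphic_trans:
  assumes "left_module R L" "mod_isomorphic R L M" "mod_isomorphic R M N"
  shows "mod_isomorphic R L N"
proof -
  obtain f g where f: "f \<in> mod_hom R L M" "bij_betw f (carrier L) (carrier M)"
    and g: "g \<in> mod_hom R M N" "bij_betw g (carrier M) (carrier N)"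
    using assms(2,3) unfolding mod_isomorphic_def by blast
  have "bij_betw (compose (carrier L) g f) (carrier L) (carrier N)"
    using bij_betw_compose[OF f(2) g(2)] .
  then show ?thesis
    unfolding mod_isomorphic_def using mod_hom_compose[OF assms(1) f(1) g(1)] by blast
qed

section \<open>Pushouts of modules within one universe\<close>

text \<open>
  A direct sum of two modules over the universe \<open>'u\<close> has its elements in \<open>'u \<times> 'u\<close>; the infinity of \<open>'u\<close>
  is what allows it to return to \<open>'u\<close>.
\<close>

lemma infinite_pair_injection:
  includes cardinal_syntax
  assumes "infinite (UNIV :: 'u set)"
  obtains e :: "'u \<times> 'u \<Rightarrow> 'u" where "inj e"
proof -
  have "|UNIV \<times> UNIV :: ('u \<times> 'u) set| \<le>o |UNIV :: 'u set|"
    using card_of_Times_same_infinite[OF assms] ordIso_iff_ordLeq by blast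
  then show ?thesis
    using that by (auto simp: card_of_ordLeq[symmetric])
qed

text \<open>
  A quotient consists of sets of elements, so it does not live in the type of its elements. Choosing
  one representative from each coset and applying the injection \<open>e\<close> brings it into any type that is
  large enough for \<open>M\<close>.
\<close>

lemma quotient_in_universe:
  fixes M :: "('r, 'a) module" and e :: "'a \<Rightarrow> 'u"
  assumes "left_module R M" "submodule_of R N M" "inj e"
  obtains Q :: "('r, 'u) module" and q where
    "left_module R Q" "q \<in> mod_hom R M Q" "q ` carrier M = carrier Q"
    "\<And>x y. x \<in> carrier M \<Longrightarrow> y \<in> carrier M \<Longrightarrow> q x = q y \<longleftrightarrow> x \<ominus>\<^bsub>M\<^esub> y \<in> N"
proof -
  interpret left_module R M by fact
  interpret N: abelian_subgroup N M using submodule_of_abelian_subgroup[OF assms(1,2)] .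
  let ?X = "mod_quotient M N"
  define i where "i = (\<lambda>X. e (SOME x. x \<in> X))"
  have ne: "X \<noteq> {}" if X: "X \<in> carrier ?X" for X
  proof -
    obtain x where x: "x \<in> carrier M" "X = N +>\<^bsub>M\<^esub> x"
      using X mod_quotient(3)[OF assms(1,2)] by auto
    then show ?thesis using N.a_rcos_self by blast
  qed
  have inj: "inj_on i (carrier ?X)"
  proof (rule inj_onI)
    fix X Y assume XY: "X \<in> carrier ?X" "Y \<in> carrier ?X" and "i X = i Y"
    then have eq: "(SOME x. x \<in> X) = (SOME x. x \<in> Y)" using \<open>inj e\<close> by (auto simp: i_def dest: injD)
    have "(SOME x. x \<in> X) \<in> X" "(SOME x. x \<in> Y) \<in> Y" using ne[OF XY(1)] ne[OF XY(2)] some_in_eq by auto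
    then have "X \<inter> Y \<noteq> {}" using eq by auto
    moreover have "X \<in> a_rcosets\<^bsub>M\<^esub> N" "Y \<in> a_rcosets\<^bsub>M\<^esub> N" using XY by (auto simp: mod_quotient_def)
    ultimately show "X = Y" using N.a_rcos_disjoint by (auto simp: pairwise_def disjnt_def)
  qed
  let ?j = "inv_into (carrier ?X) i"
  define Q :: "('r, 'u) module" where
    "Q = \<lparr>carrier = i ` carrier ?X, mult = undefined, one = undefined, zero = i \<zero>\<^bsub>?X\<^esub>,
          add = (\<lambda>u v. i (?j u \<oplus>\<^bsub>?X\<^esub> ?j v)), smult = (\<lambda>a u. i (a \<odot>\<^bsub>?X\<^esub> ?j u))\<rparr>"
  have onto: "i ` carrier ?X = carrier Q" by (simp add: Q_def)
  note image = left_module_image[OF mod_quotient(1)[OF assms(1,2)] onto]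
  have Q: "left_module R Q" and i: "restrict i (carrier ?X) \<in> mod_hom R ?X Q"
    by (rule image; simp add: Q_def inv_into_f_f[OF inj])+
  define q where "q = compose (carrier M) (restrict i (carrier ?X)) (\<lambda>x\<in>carrier M. N +>\<^bsub>M\<^esub> x)"
  have mem: "N +>\<^bsub>M\<^esub> x \<in> carrier ?X" if "x \<in> carrier M" for x
    using mod_quotient(3)[OF assms(1,2)] that by blast
  have q: "q x = i (N +>\<^bsub>M\<^esub> x)" if "x \<in> carrier M" for x
    using that mem by (simp add: q_def compose_def)
  show ?thesis
  proof (rule that[OF Q])
    show "q \<in> mod_hom R M Q"
      unfolding q_def by (rule mod_hom_compose[OF assms(1) mod_quotient(2)[OF assms(1,2)] i])
    show "q ` carrier M = carrier Q"
      using q by (simp add: onto[symmetric] mod_quotient(3)[OF assms(1,2), symmetric] image_image)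
    show "q x = q y \<longleftrightarrow> x \<ominus>\<^bsub>M\<^esub> y \<in> N" if "x \<in> carrier M" "y \<in> carrier M" for x y
      using that q mem inj_on_eq_iff[OF inj] mod_quotient(4)[OF assms(1,2) that] by simp
  qed
qed

definition direct_sum :: "('r, 'a) module \<Rightarrow> ('r, 'b) module \<Rightarrow> ('r, 'a \<times> 'b) module" where
  "direct_sum M N =
     \<lparr>carrier = carrier M \<times> carrier N, mult = undefined, one = undefined,
      zero = (\<zero>\<^bsub>M\<^esub>, \<zero>\<^bsub>N\<^esub>),
      add = (\<lambda>(x, y) (x', y'). (x \<oplus>\<^bsub>M\<^esub> x', y \<oplus>\<^bsub>N\<^esub> y')),
      smult = (\<lambda>a (x, y). (a \<odot>\<^bsub>M\<^esub> x, a \<odot>\<^bsub>N\<^esub> y))\<rparr>"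

lemma left_module_direct_sum:
  assumes "left_module R M" "left_module R N"
  shows "left_module R (direct_sum M N)"
proof -
  interpret M: left_module R M by fact
  interpret N: left_module R N by fact
  have "abelian_group (direct_sum M N)"
  proof (rule abelian_groupI)
    show "\<exists>y\<in>carrier (direct_sum M N). y \<oplus>\<^bsub>direct_sum M N\<^esub> x = \<zero>\<^bsub>direct_sum M N\<^esub>"
      if "x \<in> carrier (direct_sum M N)" for x
      using that by (auto simp: direct_sum_def M.l_neg N.l_neg
          intro!: bexI[of _ "(\<ominus>\<^bsub>M\<^esub> fst x, \<ominus>\<^bsub>N\<^esub> snd x)"])
  qed (auto simp: direct_sum_def M.a_ac N.a_ac)
  then show ?thesis
    by (intro left_moduleI) (auto simp: direct_sum_def M.R.ring_axioms M.smult_closed N.smult_closed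
        M.smult_l_distr N.smult_l_distr M.smult_r_distr N.smult_r_distr
        M.smult_assoc1 N.smult_assoc1 M.smult_one N.smult_one)
qed

text \<open>
  \<open>P\<close> is the quotient of \<open>C \<oplus> D\<close> by all \<open>(\<gamma> x, - \<delta> x)\<close>, and \<open>p\<close>, \<open>s\<close> are the two inclusions followed by
  the projection. An element \<open>z\<close> of \<open>C\<close> becomes zero in \<open>P\<close> precisely if \<open>(z, 0) = (\<gamma> x, - \<delta> x)\<close> for
  some \<open>x\<close>, which yields the description of the kernel of \<open>p\<close>. Of the universal property only the
  existence of the factorisation through \<open>p\<close> is recorded: the maps \<open>C \<rightarrow> Y\<close> that factor through \<open>p\<close> are
  those that agree on \<open>X\<close> with some map \<open>D \<rightarrow> Y\<close>.
\<close>

lemma pushout_in_universe: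
  fixes X :: "('r, 'x) module" and C D :: "('r, 'u) module"
  assumes "infinite (UNIV :: 'u set)"
    and X: "left_module R X" and C: "left_module R C" and D: "left_module R D"
    and \<gamma>: "\<gamma> \<in> mod_hom R X C" and \<delta>: "\<delta> \<in> mod_hom R X D"
  obtains P :: "('r, 'u) module" and p s where
    "left_module R P" "p \<in> mod_hom R C P" "s \<in> mod_hom R D P"
    "\<And>x. x \<in> carrier X \<Longrightarrow> p (\<gamma> x) = s (\<delta> x)"
    "\<And>(Y :: ('r, 'u) module) f h. left_module R Y \<Longrightarrow> f \<in> mod_hom R C Y \<Longrightarrow> h \<in> mod_hom R D Y \<Longrightarrow>
       (\<And>x. x \<in> carrier X \<Longrightarrow> f (\<gamma> x) = h (\<delta> x)) \<Longrightarrow>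
       \<exists>k\<in>mod_hom R P Y. compose (carrier C) k p = f"
    "a_kernel C P p = \<gamma> ` {x \<in> carrier X. \<delta> x = \<zero>\<^bsub>D\<^esub>}"
proof -
  interpret X: left_module R X by fact
  interpret C: left_module R C by fact
  interpret D: left_module R D by fact
  note \<gamma>' = mod_homD[OF \<gamma>] and \<delta>' = mod_homD[OF \<delta>]
  define S where "S = direct_sum C D"
  have S: "left_module R S" unfolding S_def by (rule left_module_direct_sum[OF C D])
  interpret S: left_module R S by fact
  have carS: "carrier S = carrier C \<times> carrier D"
    and addS: "(x, y) \<oplus>\<^bsub>S\<^esub> (x', y') = (x \<oplus>\<^bsub>C\<^esub> x', y \<oplus>\<^bsub>D\<^esub> y')"
    and zeroS: "\<zero>\<^bsub>S\<^esub> = (\<zero>\<^bsub>C\<^esub>, \<zero>\<^bsub>D\<^esub>)"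
    and smultS: "a \<odot>\<^bsub>S\<^esub> (x, y) = (a \<odot>\<^bsub>C\<^esub> x, a \<odot>\<^bsub>D\<^esub> y)" for x y x' y' a
    by (simp_all add: S_def direct_sum_def)
  have minusS: "\<ominus>\<^bsub>S\<^esub> (x, y) = (\<ominus>\<^bsub>C\<^esub> x, \<ominus>\<^bsub>D\<^esub> y)" if "x \<in> carrier C" "y \<in> carrier D" for x y
    using that by (intro S.minus_equality) (auto simp: carS addS zeroS C.l_neg D.l_neg)
  define \<nu> where "\<nu> = (\<lambda>x\<in>carrier X. (\<gamma> x, \<ominus>\<^bsub>D\<^esub> \<delta> x))"
  have \<nu>: "\<nu> \<in> mod_hom R X S"
    by (rule mod_homI)
       (auto simp: \<nu>_def carS addS smultS \<gamma>' \<delta>' X.smult_closed D.smult_minus D.minus_add)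
  define N where "N = \<nu> ` carrier X"
  have N: "submodule_of R N S"
    unfolding N_def by (rule submodule_image[OF X S \<nu> submodule_carrier[OF X]])
  obtain e :: "'u \<times> 'u \<Rightarrow> 'u" where e: "inj e"
    using infinite_pair_injection[OF assms(1)] .
  obtain P :: "('r, 'u) module" and q where P: "left_module R P" and q: "q \<in> mod_hom R S P"
    and onto: "q ` carrier S = carrier P"
    and q_eq: "\<And>x y. x \<in> carrier S \<Longrightarrow> y \<in> carrier S \<Longrightarrow> q x = q y \<longleftrightarrow> x \<ominus>\<^bsub>S\<^esub> y \<in> N"
    using quotient_in_universe[OF S N e] by blast
  interpret P: left_module R P by fact
  define p where "p = compose (carrier C) q (\<lambda>x\<in>carrier C. (x, \<zero>\<^bsub>D\<^esub>))"
  define s where "s = compose (carrier D) q (\<lambda>y\<in>carrier D. (\<zero>\<^bsub>C\<^esub>, y))"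
  have p_eq: "x \<in> carrier C \<Longrightarrow> p x = q (x, \<zero>\<^bsub>D\<^esub>)" for x by (simp add: p_def compose_def)
  have s_eq: "y \<in> carrier D \<Longrightarrow> s y = q (\<zero>\<^bsub>C\<^esub>, y)" for y by (simp add: s_def compose_def)
  have "(\<lambda>x\<in>carrier C. (x, \<zero>\<^bsub>D\<^esub>)) \<in> mod_hom R C S"
    by (rule mod_homI) (auto simp: carS addS smultS C.smult_closed D.smult_zero)
  then have p: "p \<in> mod_hom R C P" unfolding p_def by (rule mod_hom_compose[OF C _ q])
  have "(\<lambda>y\<in>carrier D. (\<zero>\<^bsub>C\<^esub>, y)) \<in> mod_hom R D S"
    by (rule mod_homI) (auto simp: carS addS smultS D.smult_closed C.smult_zero)
  then have s: "s \<in> mod_hom R D P" unfolding s_def by (rule mod_hom_compose[OF D _ q])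
  have commutes: "p (\<gamma> x) = s (\<delta> x)" if "x \<in> carrier X" for x
  proof -
    have "(\<gamma> x, \<zero>\<^bsub>D\<^esub>) \<ominus>\<^bsub>S\<^esub> (\<zero>\<^bsub>C\<^esub>, \<delta> x) = \<nu> x"
      using that by (simp add: a_minus_def minusS addS \<nu>_def \<gamma>' \<delta>')
    then have "q (\<gamma> x, \<zero>\<^bsub>D\<^esub>) = q (\<zero>\<^bsub>C\<^esub>, \<delta> x)"
      using that by (subst q_eq) (auto simp: carS N_def \<gamma>' \<delta>')
    then show ?thesis using that by (simp add: p_eq s_eq \<gamma>' \<delta>')
  qed
  have universal: "\<exists>k\<in>mod_hom R P Y. compose (carrier C) k p = f"
    if Y: "left_module R Y" and f: "f \<in> mod_hom R C Y" and h: "h \<in> mod_hom R D Y"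
      and fh: "\<And>x. x \<in> carrier X \<Longrightarrow> f (\<gamma> x) = h (\<delta> x)" for Y :: "('r, 'u) module" and f h
  proof -
    interpret Y: left_module R Y by fact
    note f' = mod_homD[OF f] and h' = mod_homD[OF h]
    define l where "l = (\<lambda>z\<in>carrier S. f (fst z) \<oplus>\<^bsub>Y\<^esub> h (snd z))"
    have l: "l \<in> mod_hom R S Y"
      by (rule mod_homI)
         (auto simp: l_def carS addS smultS f' h' C.smult_closed D.smult_closed Y.smult_r_distr Y.a_ac)
    have lN: "l z = \<zero>\<^bsub>Y\<^esub>" if "z \<in> N" for z
      using that mod_hom_minus[OF D Y h]
      by (auto simp: N_def \<nu>_def l_def carS \<gamma>' \<delta>' fh h' Y.r_neg)
    have "\<exists>k\<in>mod_hom R P Y. \<forall>z\<in>carrier S. k (q z) = l z"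
    proof (rule mod_hom_descends[OF S q onto l])
      show "l x = l y" if "x \<in> carrier S" "y \<in> carrier S" "q x = q y" for x y
        using mod_hom_cong_kernel[OF S Y l lN that(1,2)] q_eq that by simp
    qed
    then obtain k where k: "k \<in> mod_hom R P Y" and kq: "\<And>z. z \<in> carrier S \<Longrightarrow> k (q z) = l z"
      by blast
    have "compose (carrier C) k p = f"
    proof (rule mod_hom_eqI[OF mod_hom_compose[OF C p k] f])
      show "compose (carrier C) k p x = f x" if "x \<in> carrier C" for x
        using that mod_hom_zero[OF D Y h] by (simp add: compose_def p_eq kq carS l_def f')
    qed
    then show ?thesis using k by blast
  qed
  have kernel: "a_kernel C P p = \<gamma> ` {x \<in> carrier X. \<delta> x = \<zero>\<^bsub>D\<^esub>}"
  proof -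
    have minus_zero: "\<ominus>\<^bsub>C\<^esub> \<zero>\<^bsub>C\<^esub> = \<zero>\<^bsub>C\<^esub>" "\<ominus>\<^bsub>D\<^esub> \<zero>\<^bsub>D\<^esub> = \<zero>\<^bsub>D\<^esub>"
      by (rule C.minus_equality D.minus_equality; simp)+
    have pz: "p x = \<zero>\<^bsub>P\<^esub> \<longleftrightarrow> (x, \<zero>\<^bsub>D\<^esub>) \<in> N" if "x \<in> carrier C" for x
    proof -
      have "p x = \<zero>\<^bsub>P\<^esub> \<longleftrightarrow> q (x, \<zero>\<^bsub>D\<^esub>) = q (\<zero>\<^bsub>C\<^esub>, \<zero>\<^bsub>D\<^esub>)"
        using that mod_hom_zero[OF S P q] by (simp add: p_eq zeroS)
      also have "\<dots> \<longleftrightarrow> (x, \<zero>\<^bsub>D\<^esub>) \<in> N"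
        using that by (subst q_eq) (auto simp: carS a_minus_def minusS addS minus_zero)
      finally show ?thesis .
    qed
    have "(x, \<zero>\<^bsub>D\<^esub>) \<in> N \<longleftrightarrow> x \<in> \<gamma> ` {x \<in> carrier X. \<delta> x = \<zero>\<^bsub>D\<^esub>}" for x
    proof -
      have "\<nu> z = (x, \<zero>\<^bsub>D\<^esub>) \<longleftrightarrow> x = \<gamma> z \<and> \<delta> z = \<zero>\<^bsub>D\<^esub>" if "z \<in> carrier X" for z
        using that \<delta>'(2)[OF that] D.minus_minus[of "\<delta> z"] by (auto simp: \<nu>_def minus_zero)
      then show ?thesis by (auto simp: N_def image_iff) (metis+)
    qed
    then show ?thesis using pz \<gamma>' by (auto simp: a_kernel_def')
  qed
  show ?thesis using that[OF P p s commutes universal kernel] .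
qed

section \<open>Tuples and linear combinations\<close>

lemma hom_finsum:
  assumes "abelian_group_hom G H f" "finite A" "g \<in> A \<rightarrow> carrier G"
  shows "f (finsum G g A) = finsum H (\<lambda>i. f (g i)) A"
proof -
  interpret abelian_group_hom G H f by fact
  show ?thesis using assms(2,3)
    by (induction A) (auto simp: Pi_def)
qed

lemma left_module_free_mod:
  assumes "ring R" shows "left_module R (free_mod R n)"
proof -
  interpret ring R by fact
  have "abelian_group (free_mod R n)"
  proof (rule abelian_groupI)
    show "\<exists>y\<in>carrier (free_mod R n). y \<oplus>\<^bsub>free_mod R n\<^esub> x = \<zero>\<^bsub>free_mod R n\<^esub>"
      if "x \<in> carrier (free_mod R n)" for x
      using that by (intro bexI[of _ "\<lambda>i\<in>{..<n}. \<ominus>\<^bsub>R\<^esub> x i"])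
        (auto simp: free_mod_def PiE_iff l_neg)
  qed (auto simp: free_mod_def PiE_iff a_ac fun_eq_iff extensional_def)
  then show ?thesis
    by (intro left_moduleI) (auto simp: ring_axioms free_mod_def PiE_iff l_distr r_distr m_assoc
        fun_eq_iff extensional_def)
qed

text \<open>
  The homomorphism \<open>R\<^sup>n \<rightarrow> C\<close> that corresponds to the tuple \<open>c\<close>. It is restricted to the carrier so that
  it is an extensional homomorphism; its kernel is \<open>Ann(C, c)\<close>.
\<close>

definition lin_comb ::
  "('r, 'k) ring_scheme \<Rightarrow> nat \<Rightarrow> ('r, 'm) module \<Rightarrow> (nat \<Rightarrow> 'm) \<Rightarrow> (nat \<Rightarrow> 'r) \<Rightarrow> 'm" where
  "lin_comb R n C c = (\<lambda>r\<in>carrier (free_mod R n). \<Oplus>\<^bsub>C\<^esub>i\<in>{..<n}. r i \<odot>\<^bsub>C\<^esub> c i)"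

lemma lin_comb_mod_hom:
  assumes "left_module R C" "c \<in> {..<n} \<rightarrow>\<^sub>E carrier C"
  shows "lin_comb R n C c \<in> mod_hom R (free_mod R n) C"
proof -
  interpret C: left_module R C by fact
  interpret F: left_module R "free_mod R n" by (rule left_module_free_mod) (rule C.R.ring_axioms)
  have c: "i < n \<Longrightarrow> c i \<in> carrier C" for i using assms(2) by auto
  have F: "r \<in> carrier (free_mod R n) \<Longrightarrow> i < n \<Longrightarrow> r i \<in> carrier R" for r i
    by (auto simp: free_mod_def)
  show ?thesis
  proof (rule mod_homI)
    show "lin_comb R n C c \<in> carrier (free_mod R n) \<rightarrow>\<^sub>E carrier C"
      by (auto simp: lin_comb_def intro!: C.finsum_closed C.smult_closed c F)
  next
    fix x y assume xy: "x \<in> carrier (free_mod R n)" "y \<in> carrier (free_mod R n)"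
    have "(\<Oplus>\<^bsub>C\<^esub>i\<in>{..<n}. (x \<oplus>\<^bsub>free_mod R n\<^esub> y) i \<odot>\<^bsub>C\<^esub> c i) =
        (\<Oplus>\<^bsub>C\<^esub>i\<in>{..<n}. x i \<odot>\<^bsub>C\<^esub> c i \<oplus>\<^bsub>C\<^esub> y i \<odot>\<^bsub>C\<^esub> c i)"
      using xy by (intro C.finsum_cong')
        (auto simp: free_mod_def PiE_iff C.smult_l_distr c intro!: C.smult_closed C.a_closed)
    also have "\<dots> = (\<Oplus>\<^bsub>C\<^esub>i\<in>{..<n}. x i \<odot>\<^bsub>C\<^esub> c i) \<oplus>\<^bsub>C\<^esub> (\<Oplus>\<^bsub>C\<^esub>i\<in>{..<n}. y i \<odot>\<^bsub>C\<^esub> c i)"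
      using xy by (intro C.finsum_addf) (auto intro!: C.smult_closed c F)
    finally show "lin_comb R n C c (x \<oplus>\<^bsub>free_mod R n\<^esub> y) = lin_comb R n C c x \<oplus>\<^bsub>C\<^esub> lin_comb R n C c y"
      using xy by (simp add: lin_comb_def)
  next
    fix a x assume ax: "a \<in> carrier R" "x \<in> carrier (free_mod R n)"
    have "(\<Oplus>\<^bsub>C\<^esub>i\<in>{..<n}. (a \<odot>\<^bsub>free_mod R n\<^esub> x) i \<odot>\<^bsub>C\<^esub> c i) =
        (\<Oplus>\<^bsub>C\<^esub>i\<in>{..<n}. a \<odot>\<^bsub>C\<^esub> (x i \<odot>\<^bsub>C\<^esub> c i))"
      using ax by (intro C.finsum_cong')
        (auto simp: free_mod_def PiE_iff C.smult_assoc1 c intro!: C.smult_closed)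
    also have "\<dots> = a \<odot>\<^bsub>C\<^esub> (\<Oplus>\<^bsub>C\<^esub>i\<in>{..<n}. x i \<odot>\<^bsub>C\<^esub> c i)"
      using ax by (intro hom_finsum[OF C.smult_right_hom, symmetric]) (auto intro!: C.smult_closed c F)
    finally show "lin_comb R n C c (a \<odot>\<^bsub>free_mod R n\<^esub> x) = a \<odot>\<^bsub>C\<^esub> lin_comb R n C c x"
      using ax by (simp add: lin_comb_def F.smult_closed)
  qed
qed

lemma mod_hom_lin_comb:
  assumes "left_module R C" "left_module R M" "f \<in> mod_hom R C M" "c \<in> {..<n} \<rightarrow>\<^sub>E carrier C"
    and "r \<in> carrier (free_mod R n)"
  shows "f (lin_comb R n C c r) = lin_comb R n M (\<lambda>i\<in>{..<n}. f (c i)) r"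
proof -
  interpret C: left_module R C by fact
  interpret M: left_module R M by fact
  have r: "i < n \<Longrightarrow> r i \<in> carrier R" for i using assms(5) by (auto simp: free_mod_def)
  have c: "i < n \<Longrightarrow> c i \<in> carrier C" for i using assms(4) by auto
  have "f (\<Oplus>\<^bsub>C\<^esub>i\<in>{..<n}. r i \<odot>\<^bsub>C\<^esub> c i) = (\<Oplus>\<^bsub>M\<^esub>i\<in>{..<n}. f (r i \<odot>\<^bsub>C\<^esub> c i))"
    by (intro hom_finsum[OF mod_hom_abelian_group_hom[OF assms(1-3)]])
       (auto intro!: C.smult_closed c r)
  also have "\<dots> = (\<Oplus>\<^bsub>M\<^esub>i\<in>{..<n}. r i \<odot>\<^bsub>M\<^esub> (\<lambda>i\<in>{..<n}. f (c i)) i)"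
    by (intro M.finsum_cong')
       (auto simp: mod_homD(4)[OF assms(3)] c r intro!: M.smult_closed mod_homD(2)[OF assms(3)])
  finally show ?thesis using assms(5) by (simp add: lin_comb_def)
qed

lemma lin_comb_unit:
  assumes "left_module R C" "c \<in> {..<n} \<rightarrow>\<^sub>E carrier C" "i < n"
  defines "u \<equiv> (\<lambda>j\<in>{..<n}. if j = i then \<one>\<^bsub>R\<^esub> else \<zero>\<^bsub>R\<^esub>)"
  shows "u \<in> carrier (free_mod R n)" and "lin_comb R n C c u = c i"
proof -
  interpret C: left_module R C by fact
  have c: "j < n \<Longrightarrow> c j \<in> carrier C" for j using assms(2) by auto
  show u: "u \<in> carrier (free_mod R n)" by (auto simp: u_def free_mod_def)
  have "(\<Oplus>\<^bsub>C\<^esub>j\<in>{..<n}. u j \<odot>\<^bsub>C\<^esub> c j) = (\<Oplus>\<^bsub>C\<^esub>j\<in>{..<n}. if i = j then c j else \<zero>\<^bsub>C\<^esub>)"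
    by (intro C.finsum_cong') (auto simp: u_def C.smult_one C.zero_smult c)
  also have "\<dots> = c i"
    using assms(3) by (intro C.finsum_singleton) (auto intro: c)
  finally show "lin_comb R n C c u = c i" using u by (simp add: lin_comb_def)
qed

text \<open>
  Tuples can be recovered from their linear combinations. This turns equations \<open>f c = h d\<close> between
  tuples into commutative squares over \<open>R\<^sup>n\<close>, to which the pushout applies.
\<close>

lemma lin_comb_cong_iff:
  assumes "left_module R M" "x \<in> {..<n} \<rightarrow>\<^sub>E carrier M" "y \<in> {..<n} \<rightarrow>\<^sub>E carrier M"
  shows "(\<forall>r\<in>carrier (free_mod R n). lin_comb R n M x r = lin_comb R n M y r) \<longleftrightarrow> x = y"
proof
  assume eq: "\<forall>r\<in>carrier (free_mod R n). lin_comb R n M x r = lin_comb R n M y r"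
  show "x = y"
  proof (rule PiE_ext[OF assms(2,3)])
    show "x i = y i" if "i \<in> {..<n}" for i
      using eq lin_comb_unit[OF assms(1,2), of i] lin_comb_unit[OF assms(1,3), of i] that by auto
  qed
qed auto

lemma carrier_ann_module:
  "carrier (ann_module R n C c) = {r \<in> carrier (free_mod R n). lin_comb R n C c r = \<zero>\<^bsub>C\<^esub>}"
  by (auto simp: ann_module_def lin_comb_def)

section \<open>Functors and natural transformations\<close>

lemma is_functorD:
  assumes "is_functor R F"
  shows "left_module R M \<Longrightarrow> comm_group (obj F M)"
    and "left_module R M \<Longrightarrow> left_module R N \<Longrightarrow> f \<in> mod_hom R M N \<Longrightarrow>
      arr F M N f \<in> hom (obj F M) (obj F N)"
    and "left_module R M \<Longrightarrow> x \<in> carrier (obj F M) \<Longrightarrow> arr F M M (\<lambda>m\<in>carrier M. m) x = x"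
    and "left_module R L \<Longrightarrow> left_module R M \<Longrightarrow> left_module R N \<Longrightarrow> f \<in> mod_hom R L M \<Longrightarrow>
      g \<in> mod_hom R M N \<Longrightarrow> x \<in> carrier (obj F L) \<Longrightarrow>
      arr F L N (compose (carrier L) g f) x = arr F M N g (arr F L M f x)"
  using assms unfolding is_functor_def by blast+

lemma nat_transD:
  assumes "nat_trans R F G \<eta>"
  shows "left_module R M \<Longrightarrow> \<eta> M \<in> hom (obj F M) (obj G M)"
    and "left_module R M \<Longrightarrow> left_module R N \<Longrightarrow> f \<in> mod_hom R M N \<Longrightarrow> x \<in> carrier (obj F M) \<Longrightarrow>
      \<eta> N (arr F M N f x) = arr G M N f (\<eta> M x)"
    and "left_module R M \<Longrightarrow> x \<in> carrier (obj F M) \<Longrightarrow> \<eta> M x \<in> carrier (obj G M)"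
  using assms unfolding nat_trans_def hom_def by blast+

lemma nat_trans_comp:
  assumes "nat_trans R F G \<eta>" "nat_trans R G H \<theta>"
  shows "nat_trans R F H (\<lambda>M x. \<theta> M (\<eta> M x))"
  unfolding nat_trans_def
proof (intro conjI allI impI ballI)
  show "(\<lambda>x. \<theta> M (\<eta> M x)) \<in> hom (obj F M) (obj H M)" if "left_module R M" for M
    using hom_compose[OF nat_transD(1)[OF assms(1) that] nat_transD(1)[OF assms(2) that]]
    by (simp add: comp_def)
  show "\<theta> N (\<eta> N (arr F M N f x)) = arr H M N f (\<theta> M (\<eta> M x))"
    if "left_module R M" "left_module R N" "f \<in> mod_hom R M N" "x \<in> carrier (obj F M)" for M N f x
    using nat_transD(2)[OF assms(1) that] nat_transD(2)[OF assms(2) that(1-3)]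
      nat_transD(3)[OF assms(1) that(1,4)] by simp
qed

text \<open>
  Objectwise surjective transformations are cokernels of their kernels: \<open>\<eta>\<close> is defined by choosing
  preimages, and naturality can be checked on values \<open>\<pi> x\<close> because \<open>\<pi>\<close> is surjective.
\<close>

lemma nat_trans_descends:
  fixes H :: "('r, 'u, 'v) mod_functor"
  assumes H: "is_functor R H"
    and \<pi>: "nat_trans R H F \<pi>" and \<tau>: "nat_trans R H G \<tau>"
    and onto: "\<And>M. left_module R M \<Longrightarrow> \<pi> M ` carrier (obj H M) = carrier (obj F M)"
    and resp: "\<And>M x y. left_module R M \<Longrightarrow> x \<in> carrier (obj H M) \<Longrightarrow> y \<in> carrier (obj H M) \<Longrightarrow>
      \<pi> M x = \<pi> M y \<Longrightarrow> \<tau> M x = \<tau> M y"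
  obtains \<eta> where "nat_trans R F G \<eta>"
    "\<And>M x. left_module R M \<Longrightarrow> x \<in> carrier (obj H M) \<Longrightarrow> \<eta> M (\<pi> M x) = \<tau> M x"
proof -
  define \<eta> where "\<eta> = (\<lambda>M z. \<tau> M (inv_into (carrier (obj H M)) (\<pi> M) z))"
  have \<eta>: "\<eta> M (\<pi> M x) = \<tau> M x" if "left_module R M" "x \<in> carrier (obj H M)" for M x
  proof -
    have "\<pi> M x \<in> \<pi> M ` carrier (obj H M)" using that by simp
    then show ?thesis
      unfolding \<eta>_def by (intro resp inv_into_into f_inv_into_f that)
  qed
  have "nat_trans R F G \<eta>"
    unfolding nat_trans_def
  proof (intro conjI allI impI ballI)
    fix M :: "('r, 'u) module"
    assume M: "left_module R M"
    interpret H: comm_group "obj H M" using is_functorD(1)[OF H M] .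
    show "\<eta> M \<in> hom (obj F M) (obj G M)"
    proof (rule homI)
      show "\<eta> M u \<in> carrier (obj G M)" if "u \<in> carrier (obj F M)" for u
        using that nat_transD(3)[OF \<tau> M] unfolding onto[OF M, symmetric] by (auto simp: \<eta>[OF M])
      fix u v assume "u \<in> carrier (obj F M)" "v \<in> carrier (obj F M)"
      then obtain x y where xy: "x \<in> carrier (obj H M)" "y \<in> carrier (obj H M)"
        and uv: "u = \<pi> M x" "v = \<pi> M y" unfolding onto[OF M, symmetric] by blast
      have "u \<otimes>\<^bsub>obj F M\<^esub> v = \<pi> M (x \<otimes>\<^bsub>obj H M\<^esub> y)"
        using uv hom_mult[OF nat_transD(1)[OF \<pi> M] xy] by simp
      then show "\<eta> M (u \<otimes>\<^bsub>obj F M\<^esub> v) = \<eta> M u \<otimes>\<^bsub>obj G M\<^esub> \<eta> M v"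
        using uv xy \<eta>[OF M] hom_mult[OF nat_transD(1)[OF \<tau> M] xy] by simp
    qed
    fix N :: "('r, 'u) module" and f u
    assume N: "left_module R N" and f: "f \<in> mod_hom R M N" and "u \<in> carrier (obj F M)"
    then obtain x where x: "x \<in> carrier (obj H M)" "u = \<pi> M x"
      unfolding onto[OF M, symmetric] by blast
    have "arr H M N f x \<in> carrier (obj H N)"
      using is_functorD(2)[OF H M N f] x by (auto simp: hom_def)
    moreover have "arr F M N f u = \<pi> N (arr H M N f x)"
      using nat_transD(2)[OF \<pi> M N f] x by simp
    ultimately show "\<eta> N (arr F M N f u) = arr G M N f (\<eta> M u)"
      using x nat_transD(2)[OF \<tau> M N f] \<eta>[OF M] \<eta>[OF N] by simp
  qed
  then show ?thesis using that \<eta> by metis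
qed

lemma hom_functor_simps [simp]:
  "carrier (obj (hom_functor R A) M) = mod_hom R A M"
  "mult (obj (hom_functor R A) M) = (\<lambda>f g. \<lambda>x\<in>carrier A. f x \<oplus>\<^bsub>M\<^esub> g x)"
  "one (obj (hom_functor R A) M) = (\<lambda>x\<in>carrier A. \<zero>\<^bsub>M\<^esub>)"
  "arr (hom_functor R A) M N h f = compose (carrier A) h f"
  by (simp_all add: hom_functor_def)

lemma comm_group_hom_functor:
  assumes A: "left_module R A" and M: "left_module R M"
  shows "comm_group (obj (hom_functor R A) M)"
proof -
  interpret A: left_module R A by fact
  interpret M: left_module R M by fact
  note D = mod_homD[where R = R and M = A and N = M]
  have add: "(\<lambda>x\<in>carrier A. f x \<oplus>\<^bsub>M\<^esub> g x) \<in> mod_hom R A M"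
    if "f \<in> mod_hom R A M" "g \<in> mod_hom R A M" for f g
    using D(2-4)[OF that(1)] D(2-4)[OF that(2)]
    by (intro mod_homI) (simp_all add: A.smult_closed M.smult_r_distr M.a_ac)
  have zero: "(\<lambda>x\<in>carrier A. \<zero>\<^bsub>M\<^esub>) \<in> mod_hom R A M"
    by (intro mod_homI) (simp_all add: A.smult_closed M.smult_zero)
  have minus: "(\<lambda>x\<in>carrier A. \<ominus>\<^bsub>M\<^esub> f x) \<in> mod_hom R A M" if "f \<in> mod_hom R A M" for f
    using D(2-4)[OF that]
    by (intro mod_homI) (simp_all add: A.smult_closed M.smult_minus M.minus_add)
  show ?thesis
  proof (rule comm_groupI; simp add: add zero)
    show "(\<lambda>x\<in>carrier A. (if x \<in> carrier A then f x \<oplus>\<^bsub>M\<^esub> g x else undefined) \<oplus>\<^bsub>M\<^esub> h x) =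
        (\<lambda>x\<in>carrier A. f x \<oplus>\<^bsub>M\<^esub> (if x \<in> carrier A then g x \<oplus>\<^bsub>M\<^esub> h x else undefined))"
      if "f \<in> mod_hom R A M" "g \<in> mod_hom R A M" "h \<in> mod_hom R A M" for f g h
      using D(2)[OF that(1)] D(2)[OF that(2)] D(2)[OF that(3)]
      by (intro restrict_ext) (simp add: M.a_assoc)
    show "(\<lambda>x\<in>carrier A. f x \<oplus>\<^bsub>M\<^esub> g x) = (\<lambda>x\<in>carrier A. g x \<oplus>\<^bsub>M\<^esub> f x)"
      if "f \<in> mod_hom R A M" "g \<in> mod_hom R A M" for f g
      using D(2)[OF that(1)] D(2)[OF that(2)] by (intro restrict_ext) (simp add: M.a_comm)
    show "(\<lambda>x\<in>carrier A. (if x \<in> carrier A then \<zero>\<^bsub>M\<^esub> else undefined) \<oplus>\<^bsub>M\<^esub> f x) = f"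
      if f: "f \<in> mod_hom R A M" for f
      using D(2)[OF f] by (intro mod_hom_eqI[OF add[OF zero f, simplified] f]) simp
    show "\<exists>g\<in>mod_hom R A M. (\<lambda>x\<in>carrier A. g x \<oplus>\<^bsub>M\<^esub> f x) = (\<lambda>x\<in>carrier A. \<zero>\<^bsub>M\<^esub>)"
      if f: "f \<in> mod_hom R A M" for f
      using D(2)[OF f] by (intro bexI[OF _ minus[OF f]] restrict_ext) (simp add: M.l_neg)
  qed
qed

lemma is_functor_hom_functor:
  assumes "left_module R A" shows "is_functor R (hom_functor R A)"
  unfolding is_functor_def
proof (intro conjI allI impI ballI)
  show "comm_group (obj (hom_functor R A) M)" if "left_module R M" for M
    by (rule comm_group_hom_functor[OF assms that])
  show "arr (hom_functor R A) M N f \<in> hom (obj (hom_functor R A) M) (obj (hom_functor R A) N)"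
    if "left_module R M" "left_module R N" and f: "f \<in> mod_hom R M N" for M N f
  proof (rule homI)
    show "arr (hom_functor R A) M N f x \<in> carrier (obj (hom_functor R A) N)"
      if "x \<in> carrier (obj (hom_functor R A) M)" for x
      using that f mod_hom_compose[OF assms] by simp
    show "arr (hom_functor R A) M N f (x \<otimes>\<^bsub>obj (hom_functor R A) M\<^esub> y) =
        arr (hom_functor R A) M N f x \<otimes>\<^bsub>obj (hom_functor R A) N\<^esub> arr (hom_functor R A) M N f y"
      if "x \<in> carrier (obj (hom_functor R A) M)" "y \<in> carrier (obj (hom_functor R A) M)" for x y
      using that mod_homD(2)[of x R A M] mod_homD(2)[of y R A M] mod_homD(3)[OF f]
      by (auto simp: compose_def fun_eq_iff)
  qed
  show "arr (hom_functor R A) M M (\<lambda>m\<in>carrier M. m) x = x"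
    if "left_module R M" "x \<in> carrier (obj (hom_functor R A) M)" for M x
  proof -
    from that have "x \<in> mod_hom R A M" by simp
    then show ?thesis
      using mod_homD(1)[of x R A M] by (simp add: compose_def fun_eq_iff PiE_iff extensional_def)
  qed
  show "arr (hom_functor R A) L N (compose (carrier L) g f) x =
      arr (hom_functor R A) M N g (arr (hom_functor R A) L M f x)"
    if "x \<in> carrier (obj (hom_functor R A) L)" for L M N g f x
    using that mod_homD(2)[of x R A L] by (simp add: compose_def fun_eq_iff)
qed

lemma nat_trans_precompose:
  assumes A: "left_module R A" and g: "g \<in> mod_hom R A B"
  shows "nat_trans R (hom_functor R B) (hom_functor R A) (\<lambda>M f. compose (carrier A) f g)"
  unfolding nat_trans_def
proof (intro conjI allI impI ballI)
  show "(\<lambda>f. compose (carrier A) f g) \<in> hom (obj (hom_functor R B) M) (obj (hom_functor R A) M)" for M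
  proof (rule homI)
    show "compose (carrier A) f g \<in> carrier (obj (hom_functor R A) M)"
      if "f \<in> carrier (obj (hom_functor R B) M)" for f
      using that mod_hom_compose[OF A g] by simp
  qed (simp add: compose_def fun_eq_iff mod_homD(2)[OF g])
  show "compose (carrier A) (arr (hom_functor R B) M N f x) g =
      arr (hom_functor R A) M N f (compose (carrier A) x g)" for M N f x
    by (simp add: compose_def fun_eq_iff mod_homD(2)[OF g])
qed

text \<open>
  All statements reduce to the equation \<open>arrQ\<close> of the proof, which says that the arrow map of the
  quotient sends the coset of \<open>x\<close> to the coset of the image of \<open>x\<close>.
\<close>

lemma quotient_functor:
  fixes F :: "('r, 'u, 'v) mod_functor"
  assumes F: "is_functor R F" and \<psi>: "is_subfunctor R F \<psi>"
  shows "is_functor R (quotient_functor F \<psi>)"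
    and "nat_trans R F (quotient_functor F \<psi>) (\<lambda>M x. \<psi> M #>\<^bsub>obj F M\<^esub> x)"
proof -
  let ?Q = "quotient_functor F \<psi>"
  have subgroup: "subgroup (\<psi> M) (obj F M)" if "left_module R M" for M
    using \<psi> that by (auto simp: is_subfunctor_def)
  have normal: "normal (\<psi> M) (obj F M)" if "left_module R M" for M
    using comm_group.subgroup_imp_normal[OF is_functorD(1)[OF F that] subgroup[OF that]] .
  have car: "carrier (obj ?Q M) = (\<lambda>x. \<psi> M #>\<^bsub>obj F M\<^esub> x) ` carrier (obj F M)" for M
    by (simp add: quotient_functor_def carrier_FactGroup)
  have coset_mult: "(\<psi> M #>\<^bsub>obj F M\<^esub> x) \<otimes>\<^bsub>obj ?Q M\<^esub> (\<psi> M #>\<^bsub>obj F M\<^esub> y) =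
      \<psi> M #>\<^bsub>obj F M\<^esub> (x \<otimes>\<^bsub>obj F M\<^esub> y)"
    if "left_module R M" "x \<in> carrier (obj F M)" "y \<in> carrier (obj F M)" for M x y
    using normal.rcos_sum[OF normal[OF that(1)] that(2,3)] by (simp add: quotient_functor_def)
  have arrQ: "arr ?Q M N f (\<psi> M #>\<^bsub>obj F M\<^esub> x) = \<psi> N #>\<^bsub>obj F N\<^esub> arr F M N f x"
    if M: "left_module R M" and N: "left_module R N" and f: "f \<in> mod_hom R M N"
      and x: "x \<in> carrier (obj F M)" for M N f x
  proof -
    interpret FM: comm_group "obj F M" by (rule is_functorD(1)[OF F M])
    interpret FN: comm_group "obj F N" by (rule is_functorD(1)[OF F N])
    interpret PM: subgroup "\<psi> M" "obj F M" by (rule subgroup[OF M])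
    interpret PN: subgroup "\<psi> N" "obj F N" by (rule subgroup[OF N])
    have f_hom: "arr F M N f \<in> hom (obj F M) (obj F N)" by (rule is_functorD(2)[OF F M N f])
    have fx: "arr F M N f x \<in> carrier (obj F N)" using f_hom x by (auto simp: hom_def)
    have f\<psi>: "arr F M N f z \<in> \<psi> N" if "z \<in> \<psi> M" for z
      using \<psi> M N f that unfolding is_subfunctor_def by blast
    have "arr F M N f ` (\<psi> M #>\<^bsub>obj F M\<^esub> x) = (\<lambda>z. arr F M N f z \<otimes>\<^bsub>obj F N\<^esub> arr F M N f x) ` \<psi> M"
      using hom_mult[OF f_hom _ x] PM.subset by (auto simp: r_coset_def image_iff subset_iff)
    then have "arr ?Q M N f (\<psi> M #>\<^bsub>obj F M\<^esub> x) =
        \<psi> N <#>\<^bsub>obj F N\<^esub> ((\<lambda>z. arr F M N f z \<otimes>\<^bsub>obj F N\<^esub> arr F M N f x) ` \<psi> M)"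
      by (simp add: quotient_functor_def)
    also have "\<dots> = \<psi> N #>\<^bsub>obj F N\<^esub> arr F M N f x"
    proof (intro equalityI subsetI)
      fix y assume "y \<in> \<psi> N <#>\<^bsub>obj F N\<^esub> ((\<lambda>z. arr F M N f z \<otimes>\<^bsub>obj F N\<^esub> arr F M N f x) ` \<psi> M)"
      then obtain h z where hz: "h \<in> \<psi> N" "z \<in> \<psi> M"
        and y: "y = h \<otimes>\<^bsub>obj F N\<^esub> (arr F M N f z \<otimes>\<^bsub>obj F N\<^esub> arr F M N f x)"
        by (auto simp: set_mult_def)
      have "y = (h \<otimes>\<^bsub>obj F N\<^esub> arr F M N f z) \<otimes>\<^bsub>obj F N\<^esub> arr F M N f x"
        unfolding y using hz fx f\<psi>[OF hz(2)] by (simp add: FN.m_assoc)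
      moreover have "h \<otimes>\<^bsub>obj F N\<^esub> arr F M N f z \<in> \<psi> N" using hz f\<psi> by simp
      ultimately show "y \<in> \<psi> N #>\<^bsub>obj F N\<^esub> arr F M N f x" by (auto simp: r_coset_def)
    next
      fix y assume "y \<in> \<psi> N #>\<^bsub>obj F N\<^esub> arr F M N f x"
      then obtain h where h: "h \<in> \<psi> N" "y = h \<otimes>\<^bsub>obj F N\<^esub> arr F M N f x"
        by (auto simp: r_coset_def)
      have "arr F M N f \<one>\<^bsub>obj F M\<^esub> = \<one>\<^bsub>obj F N\<^esub>"
        by (rule hom_one[OF f_hom FM.is_group FN.is_group])
      then have "y = h \<otimes>\<^bsub>obj F N\<^esub> (arr F M N f \<one>\<^bsub>obj F M\<^esub> \<otimes>\<^bsub>obj F N\<^esub> arr F M N f x)"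
        using h fx by simp
      then show "y \<in> \<psi> N <#>\<^bsub>obj F N\<^esub> ((\<lambda>z. arr F M N f z \<otimes>\<^bsub>obj F N\<^esub> arr F M N f x) ` \<psi> M)"
        unfolding set_mult_def using h(1) PM.one_closed by blast
    qed
    finally show ?thesis .
  qed
  have arr_closed: "arr F M N f x \<in> carrier (obj F N)"
    if "left_module R M" "left_module R N" "f \<in> mod_hom R M N" "x \<in> carrier (obj F M)" for M N f x
    using is_functorD(2)[OF F that(1-3)] that(4) by (auto simp: hom_def)
  show proj: "nat_trans R F ?Q (\<lambda>M x. \<psi> M #>\<^bsub>obj F M\<^esub> x)"
    unfolding nat_trans_def
  proof (intro conjI allI impI ballI)
    show "(\<lambda>x. \<psi> M #>\<^bsub>obj F M\<^esub> x) \<in> hom (obj F M) (obj ?Q M)" if "left_module R M" for M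
      by (rule homI) (auto simp: car coset_mult[OF that])
  qed (simp add: arrQ)
  show "is_functor R ?Q"
    unfolding is_functor_def
  proof (intro conjI allI impI ballI)
    show "comm_group (obj ?Q M)" if "left_module R M" for M
      using comm_group.abelian_FactGroup[OF is_functorD(1)[OF F that] subgroup[OF that]]
      by (simp add: quotient_functor_def)
  next
    fix M N :: "('r, 'u) module" and f
    assume M: "left_module R M" and N: "left_module R N" and f: "f \<in> mod_hom R M N"
    interpret FM: comm_group "obj F M" by (rule is_functorD(1)[OF F M])
    have f_hom: "arr F M N f \<in> hom (obj F M) (obj F N)" by (rule is_functorD(2)[OF F M N f])
    show "arr ?Q M N f \<in> hom (obj ?Q M) (obj ?Q N)"
    proof (rule homI)
      show "arr ?Q M N f X \<in> carrier (obj ?Q N)" if "X \<in> carrier (obj ?Q M)" for X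
        using that arrQ[OF M N f] arr_closed[OF M N f] by (auto simp: car)
      fix X Y assume "X \<in> carrier (obj ?Q M)" "Y \<in> carrier (obj ?Q M)"
      then obtain x y where xy: "x \<in> carrier (obj F M)" "y \<in> carrier (obj F M)"
        and XY: "X = \<psi> M #>\<^bsub>obj F M\<^esub> x" "Y = \<psi> M #>\<^bsub>obj F M\<^esub> y"
        unfolding car by blast
      show "arr ?Q M N f (X \<otimes>\<^bsub>obj ?Q M\<^esub> Y) = arr ?Q M N f X \<otimes>\<^bsub>obj ?Q N\<^esub> arr ?Q M N f Y"
        using xy arr_closed[OF M N f]
        by (simp add: XY coset_mult[OF M] coset_mult[OF N] arrQ[OF M N f] hom_mult[OF f_hom])
    qed
  next
    fix M X assume M: "left_module R M" and "X \<in> carrier (obj ?Q M)"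
    then obtain x where x: "x \<in> carrier (obj F M)" "X = \<psi> M #>\<^bsub>obj F M\<^esub> x" unfolding car by blast
    then show "arr ?Q M M (\<lambda>m\<in>carrier M. m) X = X"
      using arrQ[OF M M mod_hom_id[OF M]] is_functorD(3)[OF F M] by simp
  next
    fix L M N :: "('r, 'u) module" and f g X
    assume L: "left_module R L" and M: "left_module R M" and N: "left_module R N"
      and f: "f \<in> mod_hom R L M" and g: "g \<in> mod_hom R M N" and "X \<in> carrier (obj ?Q L)"
    then obtain x where x: "x \<in> carrier (obj F L)" "X = \<psi> L #>\<^bsub>obj F L\<^esub> x" unfolding car by blast
    then show "arr ?Q L N (compose (carrier L) g f) X = arr ?Q M N g (arr ?Q L M f X)"
      using arrQ[OF L N mod_hom_compose[OF L f g]] arrQ[OF L M f] arrQ[OF M N g]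
        arr_closed[OF L M f] is_functorD(4)[OF F L M N f g] by simp
  qed
qed

lemma subfunctor_of_subfunctor:
  fixes \<phi> \<psi> :: "('r, 'u) module \<Rightarrow> 'v set"
  assumes F: "\<And>M :: ('r, 'u) module. left_module R M \<Longrightarrow> group (obj F M)"
    and "is_subfunctor R F \<phi>" "is_subfunctor R F \<psi>"
    and "\<And>M. left_module R M \<Longrightarrow> \<psi> M \<subseteq> \<phi> M"
  shows "is_subfunctor R (subfunctor F \<phi>) \<psi>"
  unfolding is_subfunctor_def
proof (intro conjI allI impI ballI)
  show "subgroup (\<psi> M) (obj (subfunctor F \<phi>) M)" if M: "left_module R M" for M
    using group.subgroup_incl[OF F[OF M]] assms(2-4) M by (simp add: is_subfunctor_def subfunctor_def)
qed (use assms(3) in \<open>auto simp: is_subfunctor_def subfunctor_def\<close>)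

section \<open>The defect as a kernel\<close>

text \<open>
  The formula \<open>w F = Ker p\<close> for a functor with a presentation \<open>Hom(B,-) \<rightarrow> Hom(A,-) \<rightarrow> F \<rightarrow> 0\<close> induced by
  \<open>p : A \<rightarrow> B\<close>. The unit sends \<open>\<pi> f\<close> to the restriction of \<open>f\<close> to \<open>Ker p\<close>; this is well defined since maps
  that factor through \<open>p\<close> vanish on \<open>Ker p\<close>. By Yoneda, a transformation \<open>\<theta> : F \<rightarrow> Hom(M,-)\<close> composed with
  \<open>\<pi>\<close> is precomposition with one map \<open>u : M \<rightarrow> A\<close>, the value of \<open>\<theta> \<circ> \<pi>\<close> at the identity of \<open>A\<close>. As \<open>\<pi> p = 0\<close>,
  also \<open>p \<circ> u = 0\<close>, so \<open>u\<close> takes its values in \<open>Ker p\<close> and is the required map.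
\<close>

lemma defect_of_presentation:
  fixes F :: "('r, 'u, 'v) mod_functor" and A B :: "('r, 'u) module"
  assumes F: "is_functor R F" and A: "left_module R A" and B: "left_module R B"
    and p: "p \<in> mod_hom R A B" and \<pi>: "nat_trans R (hom_functor R A) F \<pi>"
    and onto: "\<And>M. left_module R M \<Longrightarrow> \<pi> M ` mod_hom R A M = carrier (obj F M)"
    and exact: "\<And>M. left_module R M \<Longrightarrow> (\<lambda>k. compose (carrier A) k p) ` mod_hom R B M =
      kernel (obj (hom_functor R A) M) (obj F M) (\<pi> M)"
  shows "\<exists>\<eta>. is_defect R F (A\<lparr>carrier := a_kernel A B p\<rparr>) \<eta>"
proof -
  interpret A: left_module R A by fact
  interpret B: left_module R B by fact
  define K where "K = {x \<in> carrier A. p x = \<zero>\<^bsub>B\<^esub>}"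
  have K_eq: "a_kernel A B p = K" by (auto simp: K_def a_kernel_def')
  define W where "W = A\<lparr>carrier := K\<rparr>"
  have K: "submodule_of R K A" unfolding K_def by (rule submodule_kernel[OF A B p])
  have W: "left_module R W" unfolding W_def by (rule left_module_submodule[OF A K])
  have carW: "carrier W = K" by (simp add: W_def)
  have KA: "x \<in> K \<Longrightarrow> x \<in> carrier A" for x by (simp add: K_def)
  define \<iota> where "\<iota> = (\<lambda>x\<in>K. x)"
  have \<iota>: "\<iota> \<in> mod_hom R W A"
    using K by (intro mod_homI) (auto simp: \<iota>_def W_def submodule_of_def)
  note H = is_functor_hom_functor[OF A]
  have fp: "fp_functor R F"
    unfolding fp_functor_def presented_by_def
    using F A B \<pi> nat_trans_precompose[OF A p] exact onto by blast
  have agree: "compose (carrier W) f \<iota> = compose (carrier W) f' \<iota>"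
    if M: "left_module R M" and f: "f \<in> mod_hom R A M" and f': "f' \<in> mod_hom R A M"
      and eq: "\<pi> M f = \<pi> M f'" for M f f'
  proof -
    interpret M: left_module R M by fact
    let ?H = "obj (hom_functor R A) M"
    interpret H: comm_group ?H by (rule comm_group_hom_functor[OF A M])
    interpret \<pi>: group_hom ?H "obj F M" "\<pi> M"
      using nat_transD(1)[OF \<pi> M] is_functorD(1)[OF F M]
      by (intro group_hom.intro group_hom_axioms.intro) (auto simp: H.is_group comm_group_def)
    \<comment> \<open>The difference \<open>f - f'\<close> lies in the kernel of \<open>\<pi>\<close> and hence factors through \<open>p\<close>.\<close>
    define h where "h = f \<otimes>\<^bsub>?H\<^esub> inv\<^bsub>?H\<^esub> f'"
    have fH: "f \<in> carrier ?H" "f' \<in> carrier ?H" using f f' by simp_all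
    have h: "h \<in> carrier ?H" "f = h \<otimes>\<^bsub>?H\<^esub> f'"
      using fH by (simp_all only: h_def H.m_closed H.inv_closed H.m_assoc H.l_inv H.r_one)
    have "\<pi> M h = \<pi> M f \<otimes>\<^bsub>obj F M\<^esub> inv\<^bsub>obj F M\<^esub> \<pi> M f'"
      using fH by (simp only: h_def \<pi>.hom_mult \<pi>.hom_inv H.inv_closed)
    also have "\<dots> = \<one>\<^bsub>obj F M\<^esub>"
      unfolding eq by (rule \<pi>.H.r_inv) (rule \<pi>.hom_closed[OF fH(2)])
    finally have "\<pi> M h = \<one>\<^bsub>obj F M\<^esub>" .
    then have "h \<in> kernel ?H (obj F M) (\<pi> M)" using h by (simp add: kernel_def)
    then obtain k where k: "k \<in> mod_hom R B M" "h = compose (carrier A) k p"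
      using exact[OF M] by blast
    have "f x = f' x" if "x \<in> K" for x
    proof -
      have "f x = k (p x) \<oplus>\<^bsub>M\<^esub> f' x" using h(2) k(2) KA[OF that] by (simp add: compose_def)
      then show ?thesis
        using that mod_hom_zero[OF B M k(1)] mod_homD(2)[OF f'] by (simp add: K_def)
    qed
    then show ?thesis by (auto simp: compose_def \<iota>_def carW)
  qed
  obtain \<eta> where \<eta>: "nat_trans R F (hom_functor R W) \<eta>"
    and \<eta>\<pi>: "\<And>M f. left_module R M \<Longrightarrow> f \<in> mod_hom R A M \<Longrightarrow> \<eta> M (\<pi> M f) = compose (carrier W) f \<iota>"
  proof (rule nat_trans_descends[OF H \<pi> nat_trans_precompose[OF W \<iota>]])
  qed (auto simp: onto intro: agree)
  have "\<exists>!g. g \<in> mod_hom R M W \<and> (\<forall>N. left_module R N \<longrightarrow>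
      (\<forall>x\<in>carrier (obj F N). \<theta> N x = compose (carrier M) (\<eta> N x) g))"
    if M: "left_module R M" and \<theta>: "nat_trans R F (hom_functor R M) \<theta>" for M \<theta>
  proof -
    interpret M: left_module R M by fact
    define idA where "idA = (\<lambda>x\<in>carrier A. x)"
    have idA: "idA \<in> mod_hom R A A" unfolding idA_def by (rule mod_hom_id[OF A])
    have \<pi>idA: "\<pi> A idA \<in> carrier (obj F A)" using nat_transD(3)[OF \<pi> A] idA by simp
    define u where "u = \<theta> A (\<pi> A idA)"
    have u: "u \<in> mod_hom R M A" using nat_transD(3)[OF \<theta> A \<pi>idA] by (simp add: u_def)
    have yoneda: "\<theta> N (\<pi> N f) = compose (carrier M) f u"
      if N: "left_module R N" and f: "f \<in> mod_hom R A N" for N f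
    proof -
      have "f = compose (carrier A) f idA"
        using mod_homD(1)[OF f] by (auto simp: compose_def idA_def fun_eq_iff PiE_def extensional_def)
      moreover have "\<pi> N (compose (carrier A) f idA) = arr F A N f (\<pi> A idA)"
        using nat_transD(2)[OF \<pi> A N f, of idA] idA by simp
      ultimately have "\<pi> N f = arr F A N f (\<pi> A idA)" by simp
      then show ?thesis using nat_transD(2)[OF \<theta> A N f \<pi>idA] by (simp add: u_def)
    qed
    \<comment> \<open>\<open>p\<close> is the image of the identity of \<open>B\<close>, hence \<open>\<pi> p = 0\<close> by exactness.\<close>
    have "p \<in> (\<lambda>k. compose (carrier A) k p) ` mod_hom R B B"
    proof (rule image_eqI[OF _ mod_hom_id[OF B]])
      show "p = compose (carrier A) (\<lambda>x\<in>carrier B. x) p"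
        using mod_homD(1,2)[OF p] by (auto simp: compose_def fun_eq_iff PiE_def extensional_def)
    qed
    then have "\<pi> B p = \<one>\<^bsub>obj F B\<^esub>" using exact[OF B] by (simp add: kernel_def)
    moreover have "\<theta> B \<one>\<^bsub>obj F B\<^esub> = \<one>\<^bsub>obj (hom_functor R M) B\<^esub>"
      using nat_transD(1)[OF \<theta> B] is_functorD(1)[OF F B] comm_group_hom_functor[OF M B]
      by (intro hom_one) (auto simp: comm_group_def)
    ultimately have pu: "compose (carrier M) p u = (\<lambda>x\<in>carrier M. \<zero>\<^bsub>B\<^esub>)"
      using yoneda[OF B p] by simp
    have uK: "u x \<in> K" if "x \<in> carrier M" for x
      using that fun_cong[OF pu, of x] mod_homD(2)[OF u] by (simp add: compose_def K_def)
    have uW: "u \<in> mod_hom R M W"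
      using uK mod_homD[OF u] by (intro mod_homI) (auto simp: W_def PiE_def)
    show ?thesis
    proof (rule ex1I[of _ u], intro conjI allI impI ballI)
      show "u \<in> mod_hom R M W" by (rule uW)
      show "\<theta> N x = compose (carrier M) (\<eta> N x) u"
        if N: "left_module R N" and x: "x \<in> carrier (obj F N)" for N x
      proof -
        obtain f where f: "f \<in> mod_hom R A N" "x = \<pi> N f" using x onto[OF N] by blast
        then show ?thesis
          using uK by (auto simp: yoneda[OF N] \<eta>\<pi>[OF N] compose_def \<iota>_def carW fun_eq_iff)
      qed
    next
      fix g assume g: "g \<in> mod_hom R M W \<and> (\<forall>N. left_module R N \<longrightarrow>
        (\<forall>x\<in>carrier (obj F N). \<theta> N x = compose (carrier M) (\<eta> N x) g))"
      then have "u = compose (carrier M) (compose (carrier W) idA \<iota>) g"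
        using A \<pi>idA \<eta>\<pi>[OF A idA] by (simp add: u_def)
      then have "u x = g x" if "x \<in> carrier M" for x
        using that mod_homD(2)[OF conjunct1[OF g] that] KA
        by (simp add: compose_def idA_def \<iota>_def carW)
      then show "g = u" using g uW by (intro mod_hom_eqI[of g R M W u]) auto
    qed
  qed
  then have "is_defect R F W \<eta>"
    unfolding is_defect_def using fp W \<eta> by blast
  then show ?thesis by (auto simp: W_def K_eq)
qed

text \<open>
  Uniqueness of representing objects: the two units factor through each other, and both composites are
  identities because a unit factors through itself in only one way.
\<close>

lemma defect_unique:
  fixes F :: "('r, 'u, 'v) mod_functor"
  assumes "is_defect R F W \<eta>" "is_defect R F W' \<eta>'"
  shows "mod_isomorphic R W W'"
proof -
  note d = assms[unfolded is_defect_def]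
  have W: "left_module R W" and W': "left_module R W'"
    and \<eta>: "nat_trans R F (hom_functor R W) \<eta>" and \<eta>': "nat_trans R F (hom_functor R W') \<eta>'"
    using d by auto
  have \<eta>_hom: "\<eta> N x \<in> mod_hom R W N" "\<eta>' N x \<in> mod_hom R W' N"
    if "left_module R N" "x \<in> carrier (obj F N)" for N x
    using nat_transD(3)[OF \<eta> that] nat_transD(3)[OF \<eta>' that] by auto
  obtain g where g: "g \<in> mod_hom R W' W"
    and g\<eta>: "\<And>N x. left_module R N \<Longrightarrow> x \<in> carrier (obj F N) \<Longrightarrow> \<eta>' N x = compose (carrier W') (\<eta> N x) g"
    using d(1) W' \<eta>' by (metis (no_types, lifting))
  obtain h where h: "h \<in> mod_hom R W W'"
    and h\<eta>: "\<And>N x. left_module R N \<Longrightarrow> x \<in> carrier (obj F N) \<Longrightarrow> \<eta> N x = compose (carrier W) (\<eta>' N x) h"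
    using d(2) W \<eta> by (metis (no_types, lifting))
  have self: "l = (\<lambda>x\<in>carrier V. x)"
    if V: "is_defect R F V \<zeta>" and l: "l \<in> mod_hom R V V"
      and l\<zeta>: "\<And>N x. left_module R N \<Longrightarrow> x \<in> carrier (obj F N) \<Longrightarrow> \<zeta> N x = compose (carrier V) (\<zeta> N x) l"
    for V \<zeta> l
  proof -
    note dV = V[unfolded is_defect_def]
    have V': "left_module R V" and \<zeta>: "nat_trans R F (hom_functor R V) \<zeta>" using dV by auto
    have "\<zeta> N x = compose (carrier V) (\<zeta> N x) (\<lambda>x\<in>carrier V. x)"
      if "left_module R N" "x \<in> carrier (obj F N)" for N x
      using nat_transD(3)[OF \<zeta> that] mod_homD(1)[of "\<zeta> N x" R V N]
      by (simp add: compose_def fun_eq_iff PiE_iff extensional_def)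
    moreover have "\<exists>!g. g \<in> mod_hom R V V \<and> (\<forall>N. left_module R N \<longrightarrow>
        (\<forall>x\<in>carrier (obj F N). \<zeta> N x = compose (carrier V) (\<zeta> N x) g))"
      using dV V' \<zeta> by blast
    ultimately show ?thesis using l l\<zeta> mod_hom_id[OF V'] by blast
  qed
  have gh: "compose (carrier W) g h = (\<lambda>x\<in>carrier W. x)"
  proof (rule self[OF assms(1) mod_hom_compose[OF W h g]])
    show "\<eta> N x = compose (carrier W) (\<eta> N x) (compose (carrier W) g h)"
      if "left_module R N" "x \<in> carrier (obj F N)" for N x
    proof -
      have "\<eta> N x = compose (carrier W) (compose (carrier W') (\<eta> N x) g) h"
        using h\<eta>[OF that] g\<eta>[OF that] by simp
      then show ?thesis
        using compose_assoc[of h "carrier W" "carrier W'" "\<eta> N x" g] mod_homD(2)[OF h] by auto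
    qed
  qed
  have hg: "compose (carrier W') h g = (\<lambda>x\<in>carrier W'. x)"
  proof (rule self[OF assms(2) mod_hom_compose[OF W' g h]])
    show "\<eta>' N x = compose (carrier W') (\<eta>' N x) (compose (carrier W') h g)"
      if "left_module R N" "x \<in> carrier (obj F N)" for N x
    proof -
      have "\<eta>' N x = compose (carrier W') (compose (carrier W) (\<eta>' N x) h) g"
        using h\<eta>[OF that] g\<eta>[OF that] by simp
      then show ?thesis
        using compose_assoc[of g "carrier W'" "carrier W" "\<eta>' N x" h] mod_homD(2)[OF g] by auto
    qed
  qed
  have "bij_betw h (carrier W) (carrier W')"
  proof (rule bij_betw_byWitness[where f' = g])
    show "\<forall>x\<in>carrier W. g (h x) = x" using fun_cong[OF gh] by (metis compose_eq restrict_apply')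
    show "\<forall>x\<in>carrier W'. h (g x) = x" using fun_cong[OF hg] by (metis compose_eq restrict_apply')
  qed (use mod_homD(2)[OF h] mod_homD(2)[OF g] in auto)
  then show ?thesis using h by (auto simp: mod_isomorphic_def)
qed

section \<open>The defect of a pp pair\<close>

lemma group_forgetful_power:
  assumes "left_module R M" shows "group (obj (forgetful_power n) M)"
  using abelian_group.a_group[OF left_moduleD(2)[OF assms]] by (simp add: forgetful_power_def)

text \<open>
  The transformation through which a free realisation \<open>(C, c)\<close> presents \<open>\<phi>\<close> as a quotient of
  \<open>Hom(C,-)\<close>.
\<close>

lemma nat_trans_eval:
  assumes C: "left_module R C" and c: "c \<in> {..<n} \<rightarrow>\<^sub>E carrier C"
    and mem: "\<And>M f. left_module R M \<Longrightarrow> f \<in> mod_hom R C M \<Longrightarrow> (\<lambda>i\<in>{..<n}. f (c i)) \<in> \<phi> M"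
  shows "nat_trans R (hom_functor R C) (subfunctor (forgetful_power n) \<phi>) (\<lambda>M f. \<lambda>i\<in>{..<n}. f (c i))"
  unfolding nat_trans_def
proof (intro conjI allI impI ballI)
  have c': "c i \<in> carrier C" if "i < n" for i using c that by auto
  show "(\<lambda>f. \<lambda>i\<in>{..<n}. f (c i)) \<in> hom (obj (hom_functor R C) M) (obj (subfunctor (forgetful_power n) \<phi>) M)"
    if "left_module R M" for M
    by (rule homI) (auto simp: mem[OF that] subfunctor_def forgetful_power_def c' fun_eq_iff)
  show "(\<lambda>i\<in>{..<n}. arr (hom_functor R C) M N f x (c i)) =
      arr (subfunctor (forgetful_power n) \<phi>) M N f (\<lambda>i\<in>{..<n}. x (c i))" for M N f x
    by (auto simp: subfunctor_def forgetful_power_def c' compose_def fun_eq_iff)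
qed

theorem proposition5p26:
  fixes R :: "('r, 'k) ring_scheme"
    and \<phi> \<psi> :: "('r, 'u) module \<Rightarrow> (nat \<Rightarrow> 'u) set"
    and C D :: "('r, 'u) module"
    and c d :: "nat \<Rightarrow> 'u"
    and n :: nat
  assumes "ring R"
    and "infinite (UNIV :: 'u set)"
    and "pp_formula R n \<phi>"
    and "pp_formula R n \<psi>"
    and "pp_le R \<psi> \<phi>"
    and "free_realisation R n \<phi> C c"
    and "free_realisation R n \<psi> D d"
  shows "(\<exists>W \<eta>. is_defect R (pp_pair n \<phi> \<psi>) W \<eta>) \<and>
    (\<forall>W \<eta>. is_defect R (pp_pair n \<phi> \<psi>) W \<eta> \<longrightarrow>
       mod_isomorphic R W
         (mod_quotient (ann_module R n D d) (carrier (ann_module R n C c))))"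
proof -
  let ?Rn = "free_mod R n"
  define \<gamma> where "\<gamma> = lin_comb R n C c"
  define \<delta> where "\<delta> = lin_comb R n D d"
  have C: "left_module R C" and c: "c \<in> {..<n} \<rightarrow>\<^sub>E carrier C"
    and D: "left_module R D" and d: "d \<in> {..<n} \<rightarrow>\<^sub>E carrier D"
    using assms(6,7) by (auto simp: free_realisation_def fp_module_def)
  have \<phi>: "(\<lambda>f. \<lambda>i\<in>{..<n}. f (c i)) ` mod_hom R C M = \<phi> M"
    and \<psi>: "(\<lambda>f. \<lambda>i\<in>{..<n}. f (d i)) ` mod_hom R D M = \<psi> M" if "left_module R M" for M
    using assms(6,7) that by (simp_all add: free_realisation_def)
  have \<phi>I: "(\<lambda>i\<in>{..<n}. f (c i)) \<in> \<phi> M" if "left_module R M" "f \<in> mod_hom R C M" for M f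
    unfolding \<phi>[OF that(1), symmetric] using that(2) by (rule imageI)
  have \<psi>I: "(\<lambda>i\<in>{..<n}. h (d i)) \<in> \<psi> M" if "left_module R M" "h \<in> mod_hom R D M" for M h
    unfolding \<psi>[OF that(1), symmetric] using that(2) by (rule imageI)
  have le: "\<psi> M \<subseteq> \<phi> M" if "left_module R M" for M
    using assms(5) that by (simp add: pp_le_def)
  have Rn: "left_module R ?Rn" by (rule left_module_free_mod[OF assms(1)])
  have \<gamma>: "\<gamma> \<in> mod_hom R ?Rn C" unfolding \<gamma>_def by (rule lin_comb_mod_hom[OF C c])
  have \<delta>: "\<delta> \<in> mod_hom R ?Rn D" unfolding \<delta>_def by (rule lin_comb_mod_hom[OF D d])
  have tuple: "(\<lambda>i\<in>{..<n}. f (e i)) \<in> {..<n} \<rightarrow>\<^sub>E carrier M"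
    if "f \<in> mod_hom R E M" "e \<in> {..<n} \<rightarrow>\<^sub>E carrier E" for f e E M
    using that mod_homD(2)[OF that(1)] by auto
  have agree_iff: "(\<forall>r\<in>carrier ?Rn. f (\<gamma> r) = h (\<delta> r)) \<longleftrightarrow>
      (\<lambda>i\<in>{..<n}. f (c i)) = (\<lambda>i\<in>{..<n}. h (d i))"
    if M: "left_module R M" and f: "f \<in> mod_hom R C M" and h: "h \<in> mod_hom R D M" for M f h
    using lin_comb_cong_iff[OF M tuple[OF f c] tuple[OF h d]]
    by (simp add: \<gamma>_def \<delta>_def mod_hom_lin_comb[OF C M f c] mod_hom_lin_comb[OF D M h d])
  obtain P :: "('r, 'u) module" and p s where P: "left_module R P"
    and p: "p \<in> mod_hom R C P" and s: "s \<in> mod_hom R D P"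
    and ps: "\<And>r. r \<in> carrier ?Rn \<Longrightarrow> p (\<gamma> r) = s (\<delta> r)"
    and universal: "\<And>(M :: ('r, 'u) module) f h. left_module R M \<Longrightarrow> f \<in> mod_hom R C M \<Longrightarrow>
      h \<in> mod_hom R D M \<Longrightarrow> (\<And>r. r \<in> carrier ?Rn \<Longrightarrow> f (\<gamma> r) = h (\<delta> r)) \<Longrightarrow>
      \<exists>k\<in>mod_hom R P M. compose (carrier C) k p = f"
    and kernel_p: "a_kernel C P p = \<gamma> ` {r \<in> carrier ?Rn. \<delta> r = \<zero>\<^bsub>D\<^esub>}"
    by (rule pushout_in_universe[OF assms(2) Rn C D \<gamma> \<delta>]) blast
  let ?F = "subfunctor (forgetful_power n) \<phi>" and ?ev = "\<lambda>f. \<lambda>i\<in>{..<n}. f (c i)"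
  have F: "is_functor R ?F"
    using assms(3) by (simp add: pp_formula_def in_L_def presented_by_def)
  have sub: "is_subfunctor R ?F \<psi>"
    using assms(3,4) le by (intro subfunctor_of_subfunctor group_forgetful_power)
      (auto simp: pp_formula_def)
  have ev: "nat_trans R (hom_functor R C) ?F (\<lambda>M. ?ev)"
    by (rule nat_trans_eval[OF C c \<phi>I])
  define \<pi> where "\<pi> = (\<lambda>M f. \<psi> M #>\<^bsub>obj ?F M\<^esub> ?ev f)"
  have Q: "is_functor R (pp_pair n \<phi> \<psi>)"
    and \<pi>: "nat_trans R (hom_functor R C) (pp_pair n \<phi> \<psi>) \<pi>"
    unfolding pp_pair_def \<pi>_def
    by (rule quotient_functor(1)[OF F sub], rule nat_trans_comp[OF ev quotient_functor(2)[OF F sub]])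
  have carF: "carrier (obj ?F M) = \<phi> M" for M by (simp add: subfunctor_def)
  have onto: "\<pi> M ` mod_hom R C M = carrier (obj (pp_pair n \<phi> \<psi>) M)" if M: "left_module R M" for M
  proof -
    have "\<pi> M ` mod_hom R C M = (\<lambda>x. \<psi> M #>\<^bsub>obj ?F M\<^esub> x) ` \<phi> M"
      unfolding \<pi>_def \<phi>[OF M, symmetric] image_image ..
    then show ?thesis
      by (simp add: pp_pair_def quotient_functor_def carrier_FactGroup carF)
  qed
  \<comment> \<open>The coset of \<open>f c\<close> vanishes in \<open>\<phi>/\<psi>\<close> precisely if \<open>f c = h d\<close> for some \<open>h : D \<rightarrow> M\<close>, that is, if \<open>f\<close> factors
    through the pushout.\<close>
  have exact: "(\<lambda>k. compose (carrier C) k p) ` mod_hom R P M =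
      kernel (obj (hom_functor R C) M) (obj (pp_pair n \<phi> \<psi>) M) (\<pi> M)"
    if M: "left_module R M" for M
  proof -
    interpret FM: comm_group "obj ?F M" by (rule is_functorD(1)[OF F M])
    have subgroup: "subgroup (\<psi> M) (obj ?F M)" using sub M by (auto simp: is_subfunctor_def)
    have kernel: "f \<in> kernel (obj (hom_functor R C) M) (obj (pp_pair n \<phi> \<psi>) M) (\<pi> M) \<longleftrightarrow>
        f \<in> mod_hom R C M \<and> ?ev f \<in> \<psi> M" for f
    proof -
      have "\<psi> M #>\<^bsub>obj ?F M\<^esub> ?ev f = \<psi> M \<longleftrightarrow> ?ev f \<in> \<psi> M" if "f \<in> mod_hom R C M"
      proof -
        have "?ev f \<in> carrier (obj ?F M)" unfolding carF by (rule \<phi>I[OF M that])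
        then show ?thesis
          using FM.coset_join1[OF _ _ subgroup] FM.coset_join2[OF _ subgroup] by blast
      qed
      then show ?thesis
        by (auto simp: kernel_def \<pi>_def pp_pair_def quotient_functor_def)
    qed
    show ?thesis
    proof (intro equalityI subsetI)
      fix f assume "f \<in> (\<lambda>k. compose (carrier C) k p) ` mod_hom R P M"
      then obtain k where k: "k \<in> mod_hom R P M" and f: "f = compose (carrier C) k p" by blast
      have fC: "f \<in> mod_hom R C M" unfolding f by (rule mod_hom_compose[OF C p k])
      define h where "h = compose (carrier D) k s"
      have h: "h \<in> mod_hom R D M" unfolding h_def by (rule mod_hom_compose[OF D s k])
      have "\<forall>r\<in>carrier ?Rn. f (\<gamma> r) = h (\<delta> r)"
        using ps mod_homD(2)[OF \<gamma>] mod_homD(2)[OF \<delta>] by (simp add: f h_def compose_def)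
      then have "?ev f = (\<lambda>i\<in>{..<n}. h (d i))" using agree_iff[OF M fC h] by blast
      then have "?ev f \<in> \<psi> M" using \<psi>I[OF M h] by simp
      then show "f \<in> kernel (obj (hom_functor R C) M) (obj (pp_pair n \<phi> \<psi>) M) (\<pi> M)"
        using kernel fC by blast
    next
      fix f assume "f \<in> kernel (obj (hom_functor R C) M) (obj (pp_pair n \<phi> \<psi>) M) (\<pi> M)"
      then have f: "f \<in> mod_hom R C M" and "?ev f \<in> \<psi> M" using kernel by blast+
      then obtain h where h: "h \<in> mod_hom R D M" and "?ev f = (\<lambda>i\<in>{..<n}. h (d i))"
        unfolding \<psi>[OF M, symmetric] by blast
      then have "\<forall>r\<in>carrier ?Rn. f (\<gamma> r) = h (\<delta> r)" using agree_iff[OF M f h] by blast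
      then show "f \<in> (\<lambda>k. compose (carrier C) k p) ` mod_hom R P M"
        using universal[OF M f h] by blast
    qed
  qed
  define W where "W = C\<lparr>carrier := a_kernel C P p\<rparr>"
  obtain \<eta> where defect: "is_defect R (pp_pair n \<phi> \<psi>) W \<eta>"
    using defect_of_presentation[OF Q C P p \<pi> onto exact] unfolding W_def by blast
  have W: "left_module R W" using defect unfolding is_defect_def by blast
  let ?D = "ann_module R n D d" and ?AC = "carrier (ann_module R n C c)"
  have carD: "carrier ?D = {r \<in> carrier ?Rn. \<delta> r = \<zero>\<^bsub>D\<^esub>}"
    by (simp add: carrier_ann_module \<delta>_def)
  have AnnD: "submodule_of R (carrier ?D) ?Rn"
    unfolding carD by (rule submodule_kernel[OF Rn D \<delta>])
  have D_eq: "?D = ?Rn\<lparr>carrier := carrier ?D\<rparr>" by (simp add: ann_module_def)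
  have modD: "left_module R ?D"
    by (subst D_eq) (rule left_module_submodule[OF Rn AnnD])
  have onto_W: "\<gamma> ` carrier ?D = a_kernel C P p" by (simp add: carD kernel_p)
  define f where "f = restrict \<gamma> (carrier ?D)"
  have f: "f \<in> mod_hom R ?D W"
    unfolding f_def W_def using AnnD
    by (subst D_eq, intro mod_hom_restrict[OF \<gamma>]) (auto simp: onto_W submodule_of_def)
  have f_onto: "f ` carrier ?D = carrier W" by (simp add: f_def W_def onto_W)
  \<comment> \<open>\<open>d \<in> \<psi> D \<subseteq> \<phi> D\<close> yields \<open>g : C \<rightarrow> D\<close> with \<open>g c = d\<close>, so a relation between the entries of \<open>c\<close> also
    holds for those of \<open>d\<close>.\<close>
  have AC: "?AC \<subseteq> carrier ?D"
  proof
    fix r assume "r \<in> ?AC"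
    then have r: "r \<in> carrier ?Rn" "\<gamma> r = \<zero>\<^bsub>C\<^esub>" by (simp_all add: carrier_ann_module \<gamma>_def)
    have "(\<lambda>i\<in>{..<n}. (\<lambda>x\<in>carrier D. x) (d i)) \<in> \<psi> D"
      by (rule \<psi>I[OF D mod_hom_id[OF D]])
    then have "(\<lambda>i\<in>{..<n}. (\<lambda>x\<in>carrier D. x) (d i)) \<in> \<phi> D" using le[OF D] by blast
    then obtain g where eq: "(\<lambda>i\<in>{..<n}. (\<lambda>x\<in>carrier D. x) (d i)) = ?ev g"
      and g: "g \<in> mod_hom R C D"
      unfolding \<phi>[OF D, symmetric] by (rule imageE)
    have "g (\<gamma> r) = (\<lambda>x\<in>carrier D. x) (\<delta> r)"
      using agree_iff[OF D g mod_hom_id[OF D], THEN iffD2, OF eq[symmetric]] r(1) by (rule bspec)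
    then have "\<delta> r = \<zero>\<^bsub>D\<^esub>"
      using r mod_hom_zero[OF C D g] mod_homD(2)[OF \<delta> r(1)] by simp
    then show "r \<in> carrier ?D" using r(1) carD by simp
  qed
  have "?AC = {r \<in> carrier ?D. f r = \<zero>\<^bsub>W\<^esub>}"
    using AC by (auto simp: f_def W_def \<gamma>_def carrier_ann_module)
  then have iso: "mod_isomorphic R W (mod_quotient ?D ?AC)"
    using first_isomorphism[OF modD W f f_onto] by simp
  have "mod_isomorphic R W' (mod_quotient ?D ?AC)"
    if "is_defect R (pp_pair n \<phi> \<psi>) W' \<eta>'" for W' \<eta>'
    by (rule mod_isomorphic_trans[OF _ defect_unique[OF that defect] iso])
       (use that in \<open>unfold is_defect_def, blast\<close>)
  then show ?thesis using defect by blast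
qed

end
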